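(* Assume the setting described in the context (conditions on nodes, weights and equilibrium measure), with $c=k/N\in(0,1)$ a fixed rational number and $N,k\to\infty$. Let $\Gamma$ be a void. For each compact subset $F$ of $\Gamma$ there is a constant $K_F>0$ such that $$K_{N,k}(x,x)=O(e^{-K_FN})\quad\text{as }N\to\infty$$ holds for all nodes $x\in X_N\cap F$. Also, for distinct nodes $x,y\in X_N\cap F$, $$K_{N,k}(x,y)=\frac{O(e^{-K_FN})}{x-y}.$$
   Context: Nodes. $[a,b]$ is a bounded interval and $\rho^0$ is a real analytic function in a complex neighborhood of $[a,b]$ with $\rho^0(x)>0$ for all $x\in[a,b]$ and $\int_a^b\rho^0(x)\,dx=1$. For $N\in\mathbb N$ the nodes $x_{N,0}<\dots<x_{N,N-1}$ in $(a,b)$ are defined by $\int_a^{x_{N,j}}\rho^0(x)\,dx=\frac{2j+1}{2N}$, $j=0,\dots,N-1$; $X_N=\{x_{N,j}\}_{j=0}^{N-1}$. Weights. $w_N(x_{N,j})=w_{N,j}=e^{-NV_N(x_{N,j})}\prod_{n\ne j,\,0\le n\le N-1}|x_{N,j}-x_{N,n}|^{-1}$, where for all sufficiently large $N$ the function $V_N$ is real analytic in a fixed neighborhood $G$ of $[a,b]$ and $V_N(x)=V(x)+\frac{\gamma}{N}+\frac{\eta_N(x)}{N^2}$, with $V$ a fixed real analytic function in $G$, $\gamma$ a constant, and $\limsup_{N\to\infty}\sup_{z\in G}|\eta_N(z)|<\infty$. Polynomials and kernel. $p_{N,k}$, $0\le k\le N-1$, has degree exactly $k$, positive leading coefficient,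 and $\sum_{j=0}^{N-1}p_{N,k}(x_{N,j})p_{N,l}(x_{N,j})w_{N,j}=\delta_{kl}$. The reproducing kernel is $K_{N,k}(x,y)=\sqrt{w_N(x)w_N(y)}\sum_{n=0}^{k-1}p_{N,n}(x)p_{N,n}(y)$ for $x,y\in X_N$. Equilibrium measure. Put $\varphi(x)=V(x)+\int_a^b\log|x-y|\rho^0(y)\,dy$. For $c\in(0,1)$, $\mu^c_{\min}$ is the unique minimizer of $E_c[\mu]=c\int_a^b\int_a^b\log\frac1{|x-y|}\,d\mu(x)\,d\mu(y)+\int_a^b\varphi\,d\mu$ over Borel measures $\mu$ on $[a,b]$ with $\int_a^b d\mu=1$ and $0\le\mu(B)\le\frac1c\int_B\rho^0(x)\,dx$ for all Borel $B\subset[a,b]$. It has a continuous density $d\mu^c_{\min}/dx$ on $(a,b)$. The variational derivative is $\frac{\delta E_c}{\delta\mu}(x)=-2c\int_a^b\log|x-y|\,d\mu(y)+\varphi(x)$, evaluated at $\mu=\mu^c_{\min}$, and $\ell_c\in\mathbb R$ is the Lagrange multiplier for the constraint $\int d\mu=1$. Conditions on the equilibrium measure. Let $\underline{\mathcal F}$ (resp. $\overline{\mathcal F}$) be the closed set of $x\in[a,b]$ where $d\mu^c_{\min}/dx=0$ (resp. $=\rho^0(x)/c$). (1) Each connected component of $\underline{\mathcal F}$ and of $\overline{\mathcal F}$ has nonempty interior, so each of these sets is a (possibly empty) finite union of nondegenerate closed intervals. (2) For each open subinterval $I$ of $(a,b)\setminus(\underline{\mathcal F}\cup\overline{\mathcal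 F})$ and each limit point $z_0\in\underline{\mathcal F}$ of $I$, $\lim_{x\to z_0,x\in I}|x-z_0|^{-1/2}\frac{d\mu^c_{\min}}{dx}(x)\in(0,\infty)$; for each limit point $z_0\in\overline{\mathcal F}$ of $I$, $\lim_{x\to z_0,x\in I}|x-z_0|^{-1/2}\left[\frac1c\rho^0(x)-\frac{d\mu^c_{\min}}{dx}(x)\right]\in(0,\infty)$. (3) $\{a,b\}\subset\underline{\mathcal F}\cup\overline{\mathcal F}$. Voids, bands, saturated regions. A void is a maximal open subinterval of $[a,b]$ on which $\mu^c_{\min}\equiv0$; there $\delta E_c/\delta\mu>\ell_c$ strictly. A band is a maximal open subinterval on which $0<d\mu^c_{\min}/dx<\rho^0/c$ with real analytic density; there $\delta E_c/\delta\mu\equiv\ell_c$. A saturated region is a maximal open subinterval on which $d\mu^c_{\min}/dx\equiv\rho^0/c$; there $\delta E_c/\delta\mu<\ell_c$ strictly. There are finitely many of each. *)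

theory Defs
  imports "HOL-Analysis.Analysis" "HOL-Computational_Algebra.Polynomial"
begin

definition real_analytic_in :: "(complex \<Rightarrow> complex) \<Rightarrow> complex set \<Rightarrow> bool" where
  "real_analytic_in f G \<longleftrightarrow> f holomorphic_on G \<and> (\<forall>z\<in>G \<inter> \<real>. f z \<in> \<real>)"

definition real_analytic_near :: "(real \<Rightarrow> real) \<Rightarrow> real set \<Rightarrow> bool" where
  "real_analytic_near f S \<longleftrightarrow>
     (\<exists>U g. open U \<and> complex_of_real ` S \<subseteq> U \<and> g holomorphic_on U \<and>
            (\<forall>x\<in>S. g (complex_of_real x) = complex_of_real (f x)))"


definition node_density :: "real \<Rightarrow> real \<Rightarrow> (real \<Rightarrow> real) \<Rightarrow> bool" where
  "node_density a b \<rho> \<longleftrightarrow>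
     real_analytic_near \<rho> {a..b} \<and> (\<forall>x\<in>{a..b}. \<rho> x > 0) \<and> (LBINT x:{a..b}. \<rho> x) = 1"

text \<open>These equations determine the nodes uniquely, and the nodes are increasing in the
  second index, because the density is positive.\<close>

definition node_system :: "real \<Rightarrow> real \<Rightarrow> (real \<Rightarrow> real) \<Rightarrow> (nat \<Rightarrow> nat \<Rightarrow> real) \<Rightarrow> bool" where
  "node_system a b \<rho> x \<longleftrightarrow>
     (\<forall>N. \<forall>j<N. x N j \<in> {a<..<b} \<and>
        (LBINT t:{a..x N j}. \<rho> t) = (2 * real j + 1) / (2 * real N))"

definition nodes :: "(nat \<Rightarrow> nat \<Rightarrow> real) \<Rightarrow> nat \<Rightarrow> real set" where
  "nodes x N = x N ` {..<N}"

text \<open>The potentials \<open>V\<close> and (for large \<open>N\<close>) \<open>VN N\<close> are real on the real points of \<open>G\<close>, so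
  the occurrences of \<open>Re\<close> below are only type conversions.\<close>

definition weight_potentials ::
  "real \<Rightarrow> real \<Rightarrow> complex set \<Rightarrow> (complex \<Rightarrow> complex) \<Rightarrow> (nat \<Rightarrow> complex \<Rightarrow> complex)
    \<Rightarrow> real \<Rightarrow> (nat \<Rightarrow> complex \<Rightarrow> complex) \<Rightarrow> bool" where
  "weight_potentials a b G V VN \<gamma> \<eta> \<longleftrightarrow>
     open G \<and> complex_of_real ` {a..b} \<subseteq> G \<and> real_analytic_in V G \<and>
     (\<forall>\<^sub>F N in sequentially. real_analytic_in (VN N) G \<and>
        (\<forall>z\<in>G. VN N z = V z + complex_of_real \<gamma> / of_nat N + \<eta> N z / (of_nat N)^2)) \<and>
     limsup (\<lambda>N. SUP z\<in>G. ereal (cmod (\<eta> N z))) < \<infinity>"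

definition weight ::
  "(nat \<Rightarrow> nat \<Rightarrow> real) \<Rightarrow> (nat \<Rightarrow> complex \<Rightarrow> complex) \<Rightarrow> nat \<Rightarrow> real \<Rightarrow> real" where
  "weight x VN N t =
     exp (- real N * Re (VN N (complex_of_real t))) * (\<Prod>s\<in>nodes x N - {t}. inverse \<bar>t - s\<bar>)"

definition orthonormal_polys ::
  "(nat \<Rightarrow> nat \<Rightarrow> real) \<Rightarrow> (nat \<Rightarrow> complex \<Rightarrow> complex) \<Rightarrow> (nat \<Rightarrow> nat \<Rightarrow> real poly) \<Rightarrow> bool" where
  "orthonormal_polys x VN p \<longleftrightarrow>
     (\<forall>N. \<forall>k<N. degree (p N k) = k \<and> lead_coeff (p N k) > 0 \<and>
        (\<forall>l<N. (\<Sum>t\<in>nodes x N. poly (p N k) t * poly (p N l) t * weight x VN N t)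
                 = (if k = l then 1 else 0)))"

definition repr_kernel ::
  "(nat \<Rightarrow> nat \<Rightarrow> real) \<Rightarrow> (nat \<Rightarrow> complex \<Rightarrow> complex) \<Rightarrow> (nat \<Rightarrow> nat \<Rightarrow> real poly)
    \<Rightarrow> nat \<Rightarrow> nat \<Rightarrow> real \<Rightarrow> real \<Rightarrow> real" where
  "repr_kernel x VN p N k s t =
     sqrt (weight x VN N s * weight x VN N t) * (\<Sum>n<k. poly (p N n) s * poly (p N n) t)"


definition ext_field :: "real \<Rightarrow> real \<Rightarrow> (real \<Rightarrow> real) \<Rightarrow> (complex \<Rightarrow> complex) \<Rightarrow> real \<Rightarrow> real" where
  "ext_field a b \<rho> V x = Re (V (complex_of_real x)) + (LBINT y:{a..b}. ln \<bar>x - y\<bar> * \<rho> y)"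

text \<open>Admissible measures are absolutely continuous with bounded density, so the logarithmic
  kernel is integrable and the value of \<open>ln\<close> at 0 is irrelevant.\<close>

definition energy ::
  "real \<Rightarrow> real \<Rightarrow> (real \<Rightarrow> real) \<Rightarrow> (complex \<Rightarrow> complex) \<Rightarrow> real \<Rightarrow> real measure \<Rightarrow> real" where
  "energy a b \<rho> V c \<mu> =
     c * (LINT x|\<mu>. LINT y|\<mu>. ln (1 / \<bar>x - y\<bar>)) + (LINT x|\<mu>. ext_field a b \<rho> V x)"

definition admissible :: "real \<Rightarrow> real \<Rightarrow> (real \<Rightarrow> real) \<Rightarrow> real \<Rightarrow> real measure \<Rightarrow> bool" where
  "admissible a b \<rho> c \<mu> \<longleftrightarrow>
     sets \<mu> = sets (restrict_space borel {a..b}) \<and> emeasure \<mu> {a..b} = 1 \<and>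
     (\<forall>B\<in>sets \<mu>. emeasure \<mu> B \<le> (\<integral>\<^sup>+x\<in>B. ennreal (\<rho> x / c) \<partial>lborel))"

definition equilibrium_measure ::
  "real \<Rightarrow> real \<Rightarrow> (real \<Rightarrow> real) \<Rightarrow> (complex \<Rightarrow> complex) \<Rightarrow> real \<Rightarrow> real measure \<Rightarrow> bool" where
  "equilibrium_measure a b \<rho> V c \<mu> \<longleftrightarrow> is_arg_min (energy a b \<rho> V c) (admissible a b \<rho> c) \<mu>"

definition continuous_density :: "real \<Rightarrow> real \<Rightarrow> real measure \<Rightarrow> (real \<Rightarrow> real) \<Rightarrow> bool" where
  "continuous_density a b \<mu> \<psi> \<longleftrightarrow>
     continuous_on {a<..<b} \<psi> \<and> (\<forall>x\<in>{a<..<b}. 0 \<le> \<psi> x) \<and>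
     \<mu> = density (restrict_space lborel {a..b}) (\<lambda>x. ennreal (\<psi> x))"

definition var_deriv ::
  "real \<Rightarrow> real \<Rightarrow> (real \<Rightarrow> real) \<Rightarrow> (complex \<Rightarrow> complex) \<Rightarrow> real \<Rightarrow> real measure \<Rightarrow> real \<Rightarrow> real" where
  "var_deriv a b \<rho> V c \<mu> x = - 2 * c * (LINT y|\<mu>. ln \<bar>x - y\<bar>) + ext_field a b \<rho> V x"


text \<open>The density is only given on the open interval; the closure decides whether an endpoint
  belongs to the set.\<close>

definition lower_set :: "real \<Rightarrow> real \<Rightarrow> (real \<Rightarrow> real) \<Rightarrow> real set" where
  "lower_set a b \<psi> = closure {x\<in>{a<..<b}. \<psi> x = 0}"

definition upper_set :: "real \<Rightarrow> real \<Rightarrow> (real \<Rightarrow> real) \<Rightarrow> real \<Rightarrow> (real \<Rightarrow> real) \<Rightarrow> real set" where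
  "upper_set a b \<rho> c \<psi> = closure {x\<in>{a<..<b}. \<psi> x = \<rho> x / c}"

definition regular_density ::
  "real \<Rightarrow> real \<Rightarrow> (real \<Rightarrow> real) \<Rightarrow> real \<Rightarrow> (real \<Rightarrow> real) \<Rightarrow> bool" where
  "regular_density a b \<rho> c \<psi> \<longleftrightarrow>
     (let L = lower_set a b \<psi>; U = upper_set a b \<rho> c \<psi> in
       (\<forall>S\<in>{L, U}. finite (components S) \<and> (\<forall>C\<in>components S. interior C \<noteq> {})) \<and>
       (\<forall>u v. u < v \<and> {u<..<v} \<subseteq> {a<..<b} - (L \<union> U) \<longrightarrow>
          (\<forall>z\<in>L. z islimpt {u<..<v} \<longrightarrow>
             (\<exists>l>0. ((\<lambda>x. \<bar>x - z\<bar> powr (- 1/2) * \<psi> x) \<longlongrightarrow> l) (at z within {u<..<v}))) \<and>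
          (\<forall>z\<in>U. z islimpt {u<..<v} \<longrightarrow>
             (\<exists>l>0. ((\<lambda>x. \<bar>x - z\<bar> powr (- 1/2) * (\<rho> x / c - \<psi> x)) \<longlongrightarrow> l)
                       (at z within {u<..<v})))) \<and>
       {a, b} \<subseteq> L \<union> U)"

definition open_subinterval :: "real \<Rightarrow> real \<Rightarrow> real set \<Rightarrow> bool" where
  "open_subinterval a b I \<longleftrightarrow> (\<exists>u v. a \<le> u \<and> u < v \<and> v \<le> b \<and> I = {u<..<v})"

definition maximal_subinterval :: "real \<Rightarrow> real \<Rightarrow> (real set \<Rightarrow> bool) \<Rightarrow> real set \<Rightarrow> bool" where
  "maximal_subinterval a b P I \<longleftrightarrow>
     open_subinterval a b I \<and> P I \<and>
     (\<forall>J. open_subinterval a b J \<and> P J \<and> I \<subseteq> J \<longrightarrow> J = I)"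

definition void_interval :: "real \<Rightarrow> real \<Rightarrow> real measure \<Rightarrow> real set \<Rightarrow> bool" where
  "void_interval a b \<mu> = maximal_subinterval a b (\<lambda>I. emeasure \<mu> I = 0)"

definition band_interval ::
  "real \<Rightarrow> real \<Rightarrow> (real \<Rightarrow> real) \<Rightarrow> real \<Rightarrow> (real \<Rightarrow> real) \<Rightarrow> real set \<Rightarrow> bool" where
  "band_interval a b \<rho> c \<psi> =
     maximal_subinterval a b (\<lambda>I. \<forall>x\<in>I. 0 < \<psi> x \<and> \<psi> x < \<rho> x / c)"

definition saturated_interval ::
  "real \<Rightarrow> real \<Rightarrow> (real \<Rightarrow> real) \<Rightarrow> real \<Rightarrow> (real \<Rightarrow> real) \<Rightarrow> real set \<Rightarrow> bool" where
  "saturated_interval a b \<rho> c \<psi> = maximal_subinterval a b (\<lambda>I. \<forall>x\<in>I. \<psi> x = \<rho> x / c)"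

text \<open>The Euler-Lagrange conditions in strict form. There is always at least one band (the
  total mass is 1 and \<open>0 < c < 1\<close>), so they determine the multiplier \<open>ell\<close>.\<close>

definition strict_variational_conditions ::
  "real \<Rightarrow> real \<Rightarrow> (real \<Rightarrow> real) \<Rightarrow> (complex \<Rightarrow> complex) \<Rightarrow> real \<Rightarrow> real measure
    \<Rightarrow> (real \<Rightarrow> real) \<Rightarrow> real \<Rightarrow> bool" where
  "strict_variational_conditions a b \<rho> V c \<mu> \<psi> ell \<longleftrightarrow>
     (\<forall>I. void_interval a b \<mu> I \<longrightarrow> (\<forall>x\<in>I. var_deriv a b \<rho> V c \<mu> x > ell)) \<and>
     (\<forall>I. band_interval a b \<rho> c \<psi> I \<longrightarrow>
        real_analytic_near \<psi> I \<and> (\<forall>x\<in>I. var_deriv a b \<rho> V c \<mu> x = ell)) \<and>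
     (\<forall>I. saturated_interval a b \<rho> c \<psi> I \<longrightarrow> (\<forall>x\<in>I. var_deriv a b \<rho> V c \<mu> x < ell))"

end

theory Submission
  imports Defs "HOL-Real_Asymp.Real_Asymp"
begin

text \<open>No Riemann-Hilbert analysis is needed. If \<open>Y\<close> is any set of \<open>k\<close> nodes with Lagrange basis
  \<open>l\<^sub>t\<close>, then interpolation at \<open>Y\<close> and the Cauchy-Schwarz inequality give
  \<open>K(s,s) \<le> w(s) (\<Sum>t\<in>Y. l\<^sub>t(s)\<^sup>2 / w(t))\<close>. Because \<open>c \<mu>\<close> is dominated by \<open>\<rho>\<close>, one can choose \<open>Y\<close> with
  counting function within 1 of \<open>N c \<mu>\<close>. The logarithms of all products in the weights and in \<open>l\<^sub>t\<close>
  are then \<open>N\<close> times logarithmic potentials up to \<open>O(log N)\<close>, so each summand is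
  \<open>exp (N (var t - var s) + O(log N))\<close> with \<open>var\<close> the variational derivative. Points of \<open>Y\<close> lie within \<open>O(1/N)\<close> of the support of
  \<open>\<mu>\<close>, where \<open>var t \<le> ell\<close>, while \<open>var s \<ge> ell + \<delta>\<close> on a compact subset of a void. The off-diagonal
  bound follows by the Cauchy-Schwarz inequality for the kernel, as \<open>\<bar>s - t\<bar> \<le> b - a\<close>.\<close>

section \<open>Interpolation bound for the kernel\<close>

text \<open>The obstacle is the singularity of the logarithm. Nodes are at least
  \<open>\<epsilon> = 1 / (H * real N)\<close> apart, so in the sums the logarithm may be cut off at
  distance \<epsilon>. On the side of the measures, whose densities are bounded, the cutoff changes
  \<open>N\<close> times a potential only by \<open>O(N \<epsilon>) = O(1)\<close>. The cut-off
  logarithm is monotone in the distance and its range has length \<open>O(log N)\<close>, so a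
  counting discrepancy bounded independently of \<open>N\<close> costs \<open>O(log N)\<close>, as
  in Koksma's inequality. Hence \<open>Y\<close> is chosen through counting functions. The upper
  constraint makes this possible with distinct nodes: \<open>c\<close> times the equilibrium measure
  puts mass at most \<open>1 / N\<close> between consecutive nodes, so one new point per node
  suffices. The rate: compactness of \<open>F\<close> gives a gap \<delta> of the variational
  derivative above \<open>ell\<close>. The distance from \<open>Y\<close> to the support costs
  \<open>\<delta> / 4\<close>; the logarithmic errors and the number of summands cost another
  \<open>\<delta> / 4\<close>. This leaves \<open>K\<^sub>F = \<delta> / 2\<close>.\<close>

lemma lagrange_interpolation:
  fixes P :: "'a::field poly"
  assumes "finite Y" "degree P < card Y"
  shows "poly P s = (\<Sum>t\<in>Y. poly P t * (\<Prod>y\<in>Y - {t}. (s - y) / (t - y)))"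
proof -
  define l where "l t = (\<Prod>y\<in>Y - {t}. smult (inverse (t - y)) [:- y, 1:])" for t
  define Q where "Q = (\<Sum>t\<in>Y. smult (poly P t) (l t))"
  have l: "poly (l t) z = (\<Prod>y\<in>Y - {t}. (z - y) / (t - y))" for t z
    unfolding l_def poly_prod by (intro prod.cong refl) (simp add: divide_inverse algebra_simps)
  have l_node: "poly (l t) z = (if z = t then 1 else 0)" if "t \<in> Y" "z \<in> Y" for t z
  proof (cases "z = t")
    case False
    then have "z \<in> Y - {t}" using that by auto
    with False show ?thesis
      using assms(1) by (auto simp: l intro!: prod_zero bexI[of _ z])
  next
    case True
    have "(\<Prod>y\<in>Y - {t}. (t - y) / (t - y)) = 1" by (rule prod.neutral) auto
    with True show ?thesis by (simp only: l simp_thms if_True)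
  qed
  have "degree (l t) \<le> card Y - 1" if "t \<in> Y" for t
  proof -
    have "degree (l t) \<le> (\<Sum>y\<in>Y - {t}. degree (smult (inverse (t - y)) [:- y, 1:]))"
      using degree_prod_sum_le[of "Y - {t}" "\<lambda>y. smult (inverse (t - y)) [:- y, 1:]"] assms(1)
      unfolding l_def o_def by blast
    also have "\<dots> \<le> (\<Sum>y\<in>Y - {t}. 1)"
      by (intro sum_mono order.trans[OF degree_smult_le]) auto
    finally show ?thesis using that assms(1) by simp
  qed
  then have "degree Q \<le> card Y - 1"
    unfolding Q_def by (intro degree_sum_le assms) (auto intro: order.trans[OF degree_smult_le])
  then have "degree Q < card Y" using assms by linarith
  moreover have "poly P z = poly Q z" if "z \<in> Y" for z
    using that assms(1) by (simp add: Q_def poly_sum l_node if_distrib cong: if_cong)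
  ultimately have "P = Q"
    using assms by (intro poly_eqI_degree[of Y]) auto
  then show ?thesis
    by (metis (no_types, lifting) Q_def l poly_smult poly_sum sum.cong)
qed

text \<open>The left-hand side is \<open>P s\<close> and also the squared norm of \<open>P = (\<Sum>n<k. p n s * p n)\<close>;
  interpolating \<open>P\<close> at \<open>Y\<close> and applying the Cauchy-Schwarz inequality bounds it.\<close>

lemma christoffel_le_lagrange:
  fixes p :: "nat \<Rightarrow> real poly"
  assumes X: "finite X" "\<And>t. t \<in> X \<Longrightarrow> 0 < w t"
    and degree: "\<And>n. n < k \<Longrightarrow> degree (p n) < k"
    and orth: "\<And>m n. m < k \<Longrightarrow> n < k \<Longrightarrow>
      (\<Sum>t\<in>X. poly (p m) t * poly (p n) t * w t) = (if m = n then 1 else 0)"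
    and Y: "Y \<subseteq> X" "card Y = k"
  shows "(\<Sum>n<k. poly (p n) s * poly (p n) s)
    \<le> (\<Sum>t\<in>Y. (\<Prod>y\<in>Y - {t}. (s - y) / (t - y))\<^sup>2 / w t)"
proof (cases "k = 0")
  case True
  with Y X show ?thesis by (auto dest: finite_subset)
next
  case False
  define P where "P = (\<Sum>n<k. smult (poly (p n) s) (p n))"
  define A where "A = (\<Sum>n<k. poly (p n) s * poly (p n) s)"
  define c where "c t = (\<Prod>y\<in>Y - {t}. (s - y) / (t - y))" for t
  define B where "B = (\<Sum>t\<in>Y. (c t)\<^sup>2 / w t)"
  have finY: "finite Y" using X Y finite_subset by blast
  have w: "0 < w t" if "t \<in> Y" for t using that X Y by auto
  have "degree P \<le> k - 1"
    unfolding P_def using degree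
    by (intro degree_sum_le) (force intro: order.trans[OF degree_smult_le])+
  then have degP: "degree P < k" using False by simp
  have A_eq: "A = poly P s" by (simp add: A_def P_def poly_sum)
  have "(\<Sum>t\<in>X. (poly P t)\<^sup>2 * w t)
    = (\<Sum>t\<in>X. \<Sum>m<k. \<Sum>n<k. poly (p m) s * poly (p n) s * (poly (p m) t * poly (p n) t * w t))"
    unfolding P_def poly_sum power2_eq_square sum_product sum_distrib_right
    by (simp add: sum_distrib_left sum_distrib_right mult_ac)
  also have "\<dots> = (\<Sum>m<k. \<Sum>n<k. \<Sum>t\<in>X. poly (p m) s * poly (p n) s * (poly (p m) t * poly (p n) t * w t))"
    by (subst sum.swap, intro sum.cong refl, subst sum.swap, rule refl)
  also have "\<dots> = (\<Sum>m<k. \<Sum>n<k. poly (p m) s * poly (p n) s * (if m = n then 1 else 0))"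
    by (simp add: sum_distrib_left[symmetric] orth)
  also have "\<dots> = A" by (simp add: A_def if_distrib[of "(*) _"] cong: if_cong)
  finally have norm: "(\<Sum>t\<in>X. (poly P t)\<^sup>2 * w t) = A" .
  have "A = (\<Sum>t\<in>Y. (c t / sqrt (w t)) * (poly P t * sqrt (w t)))"
  proof -
    have "c t / sqrt (w t) * (poly P t * sqrt (w t)) = poly P t * c t" if "t \<in> Y" for t
      using w[OF that] by simp
    then show ?thesis
      unfolding A_eq using lagrange_interpolation[of Y P s] degP Y finY by (simp add: c_def)
  qed
  then have "A\<^sup>2 = (\<Sum>t\<in>Y. (c t / sqrt (w t)) * (poly P t * sqrt (w t)))\<^sup>2" by simp
  also have "\<dots> \<le> (\<Sum>t\<in>Y. (c t / sqrt (w t))\<^sup>2) * (\<Sum>t\<in>Y. (poly P t * sqrt (w t))\<^sup>2)"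
    by (rule Cauchy_Schwarz_ineq_sum)
  also have "(\<Sum>t\<in>Y. (c t / sqrt (w t))\<^sup>2) = B"
    unfolding B_def using w by (intro sum.cong) (auto simp: power_divide less_imp_le)
  also have "(\<Sum>t\<in>Y. (poly P t * sqrt (w t))\<^sup>2) = (\<Sum>t\<in>Y. (poly P t)\<^sup>2 * w t)"
    using w by (intro sum.cong) (auto simp: power_mult_distrib less_imp_le)
  \<comment> \<open>Enlarging the sum from \<open>Y\<close> to \<open>X\<close> adds nonnegative
    terms, so the norm \<open>A\<close> reappears on the right and cancels one factor
    \<open>A\<close> on the left.\<close>
  also have "\<dots> \<le> A"
    unfolding norm[symmetric] using X Y by (intro sum_mono2) (auto simp: less_imp_le)
  finally have "A\<^sup>2 \<le> B * A"
    using w by (simp add: B_def sum_nonneg mult_left_mono less_imp_le)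
  moreover have "0 \<le> B" unfolding B_def using w by (intro sum_nonneg) (simp add: less_imp_le)
  moreover have "0 \<le> A" by (simp add: A_def sum_nonneg)
  ultimately have "A \<le> B" by (cases "A = 0") (auto simp: power2_eq_square)
  then show ?thesis by (simp add: A_def B_def c_def)
qed

section \<open>Logarithmic potentials and logarithmic sums\<close>

text \<open>The antiderivative \<open>F\<close> is continuous across \<open>y = x\<close> because
  \<open>u * ln \<bar>u\<bar>\<close> tends to 0 at 0. Therefore the fundamental theorem applies
  with the single exceptional point \<open>x\<close>.\<close>

lemma has_integral_log_singularity:
  fixes x \<epsilon> :: real
  assumes "0 < \<epsilon>"
  shows "((\<lambda>y. ln \<epsilon> - ln \<bar>x - y\<bar>) has_integral 2 * \<epsilon>) {x - \<epsilon>..x + \<epsilon>}"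
proof -
  define F where "F y = (y - x) + (y - x) * ln \<epsilon> - (y - x) * ln \<bar>y - x\<bar>" for y
  have "((\<lambda>u::real. u * ln \<bar>u\<bar>) \<longlongrightarrow> 0) (at 0)"
    by (rule filterlim_split_at; real_asymp)
  then have "isCont (\<lambda>u::real. u * ln \<bar>u\<bar>) 0"
    by (simp add: isCont_def)
  moreover have "isCont (\<lambda>u::real. u * ln \<bar>u\<bar>) u" if "u \<noteq> 0" for u
    using that by (intro continuous_intros) auto
  ultimately have cont: "continuous_on UNIV (\<lambda>u::real. u * ln \<bar>u\<bar>)"
    by (metis continuous_at_imp_continuous_on)
  have "continuous_on {x - \<epsilon>..x + \<epsilon>} F"
    unfolding F_def
    by (intro continuous_intros continuous_on_compose2[OF cont]) auto
  moreover have "(F has_vector_derivative ln \<epsilon> - ln \<bar>x - y\<bar>) (at y)" if "y \<noteq> x" for y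
  proof -
    have "((\<lambda>y. ln \<bar>y - x\<bar>) has_real_derivative 1 / (y - x)) (at y)"
    proof (cases "x < y")
      case True
      have "((\<lambda>y. ln (y - x)) has_real_derivative 1 / (y - x)) (at y)"
        using True by (auto intro!: derivative_eq_intros)
      then show ?thesis
        by (rule has_field_derivative_transform_within_open[where S = "{x<..}"]) (use True in auto)
    next
      case False
      have "((\<lambda>y. ln (x - y)) has_real_derivative 1 / (y - x)) (at y)"
        using False that by (auto intro!: derivative_eq_intros simp: divide_simps)
      then show ?thesis
        by (rule has_field_derivative_transform_within_open[where S = "{..<x}"]) (use False that in auto)
    qed
    moreover define l where "l = (\<lambda>y. ln \<bar>y - x\<bar>)"
    ultimately have l: "(l has_real_derivative 1 / (y - x)) (at y)"
      by simp
    have "F = (\<lambda>y. (y - x) + (y - x) * ln \<epsilon> - (y - x) * l y)"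
      by (simp add: F_def l_def fun_eq_iff)
    then have "(F has_real_derivative ln \<epsilon> - l y) (at y)"
      using that by (auto intro!: derivative_eq_intros l)
    then show ?thesis
      by (simp add: has_real_derivative_iff_has_vector_derivative l_def abs_minus_commute)
  qed
  ultimately have "((\<lambda>y. ln \<epsilon> - ln \<bar>x - y\<bar>) has_integral F (x + \<epsilon>) - F (x - \<epsilon>)) {x - \<epsilon>..x + \<epsilon>}"
    using assms by (intro fundamental_theorem_of_calculus_interior_strong[of "{x}"]) auto
  moreover have "F (x + \<epsilon>) - F (x - \<epsilon>) = 2 * \<epsilon>"
    using assms by (simp add: F_def algebra_simps)
  ultimately show ?thesis by simp
qed

lemma nn_integral_log_singularity:
  fixes x \<epsilon> :: real
  assumes "0 < \<epsilon>"
  shows "(\<integral>\<^sup>+y. ennreal (ln (max \<bar>x - y\<bar> \<epsilon>) - ln \<bar>x - y\<bar>) \<partial>lborel) \<le> ennreal (2 * \<epsilon>)"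
proof -
  \<comment> \<open>At \<open>y = x\<close> the formula would involve \<open>ln 0\<close> and could
    be negative; dropping this null point makes \<open>g\<close> nonnegative everywhere.\<close>
  define g where "g y = (if y \<in> {x - \<epsilon>..x + \<epsilon>} - {x} then ln \<epsilon> - ln \<bar>x - y\<bar> else 0)" for y
  have "((\<lambda>y. if y \<in> {x - \<epsilon>..x + \<epsilon>} then ln \<epsilon> - ln \<bar>x - y\<bar> else 0) has_integral 2 * \<epsilon>) UNIV"
    using has_integral_log_singularity[OF assms] by (subst has_integral_restrict_UNIV)
  then have "(g has_integral 2 * \<epsilon>) UNIV"
    by (rule has_integral_spike[of "{x}", rotated 2]) (auto simp: g_def)
  moreover have "g \<in> borel_measurable borel" unfolding g_def by measurable
  moreover have "0 \<le> g y" for y using assms by (auto simp: g_def)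
  ultimately have "integral\<^sup>N lborel g = ennreal (2 * \<epsilon>)"
    by (intro nn_integral_has_integral_lborel)
  moreover have "(\<integral>\<^sup>+y. ennreal (ln (max \<bar>x - y\<bar> \<epsilon>) - ln \<bar>x - y\<bar>) \<partial>lborel) \<le> integral\<^sup>N lborel g"
    using AE_lborel_singleton[of x]
    by (intro nn_integral_mono_AE) (auto simp: g_def max_def abs_if elim!: eventually_mono)
  ultimately show ?thesis by simp
qed

text \<open>Layer-cake formula: for fixed \<open>y\<close>, the levels \<open>r\<close> in
  \<open>{\<alpha>..\<beta>}\<close> with \<open>g y \<le> r\<close> form an interval of length
  \<open>\<beta> - g y\<close>, and Fubini integrates this over \<open>y\<close>. It serves both for
  the counting measure on \<open>Y\<close> and for a measure with bounded density, so that a sum and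
  an integral can be compared level by level.\<close>

lemma (in finite_measure) integral_eq_sublevel_integral:
  fixes g :: "'a \<Rightarrow> real"
  assumes [measurable]: "g \<in> borel_measurable M"
    and bounds: "AE y in M. \<alpha> \<le> g y \<and> g y \<le> \<beta>"
  shows "(LINT y|M. g y) = \<beta> * measure M (space M) - (LBINT r:{\<alpha>..\<beta>}. measure M {y \<in> space M. g y \<le> r})"
    and "set_integrable lborel {\<alpha>..\<beta>} (\<lambda>r. measure M {y \<in> space M. g y \<le> r})"
proof -
  interpret pair_sigma_finite M lborel ..
  define f where "f y r = indicat_real {\<alpha>..\<beta>} r * (if g y \<le> r then 1 else 0)" for y r
  have [measurable]: "case_prod f \<in> borel_measurable (M \<Otimes>\<^sub>M lborel)"
    unfolding f_def by measurable
  have int: "integrable (M \<Otimes>\<^sub>M lborel) (case_prod f)"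
  proof (rule integrableI_bounded_set[where A = "space M \<times> {\<alpha>..\<beta>}" and B = 1])
    show "emeasure (M \<Otimes>\<^sub>M lborel) (space M \<times> {\<alpha>..\<beta>}) < \<infinity>"
      by (subst lborel.emeasure_pair_measure_Times)
         (use emeasure_finite[of "space M"] in
           \<open>auto simp: ennreal_mult_eq_top_iff less_top[symmetric] emeasure_lborel_Icc_eq\<close>)
  qed (auto simp: f_def indicator_def space_pair_measure)
  have inner: "(LINT y|M. f y r) = indicat_real {\<alpha>..\<beta>} r * measure M {y \<in> space M. g y \<le> r}" for r
  proof -
    have "(LINT y|M. f y r) = (LINT y|M. indicat_real {\<alpha>..\<beta>} r * indicat_real {y \<in> space M. g y \<le> r} y)"
      unfolding f_def by (intro Bochner_Integration.integral_cong) auto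
    then show ?thesis by simp
  qed
  show "set_integrable lborel {\<alpha>..\<beta>} (\<lambda>r. measure M {y \<in> space M. g y \<le> r})"
    using integrable_snd[OF int] by (simp add: inner set_integrable_def)
  have g_eq: "AE y in M. (LINT r|lborel. f y r) = \<beta> - g y"
    using bounds
  proof eventually_elim
    case (elim y)
    have "(LINT r|lborel. f y r) = (LINT r|lborel. indicat_real {g y..\<beta>} r)"
      using elim by (intro Bochner_Integration.integral_cong) (auto simp: f_def indicator_def)
    then show ?case using elim by simp
  qed
  have int_g: "integrable M g"
    by (rule integrable_const_bound[of _ "max \<bar>\<alpha>\<bar> \<bar>\<beta>\<bar>"], rule eventually_mono[OF bounds]) auto
  have "(LBINT r:{\<alpha>..\<beta>}. measure M {y \<in> space M. g y \<le> r}) = (LINT r|lborel. LINT y|M. f y r)"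
    by (simp add: inner set_lebesgue_integral_def)
  also have "\<dots> = (LINT y|M. LINT r|lborel. f y r)"
    by (rule Fubini_integral[OF int])
  also have "\<dots> = (LINT y|M. \<beta> - g y)"
    using g_eq by (intro integral_cong_AE) auto
  also have "\<dots> = \<beta> * measure M (space M) - (LINT y|M. g y)"
    using int_g by simp
  finally show "(LINT y|M. g y) = \<beta> * measure M (space M) - (LBINT r:{\<alpha>..\<beta>}. measure M {y \<in> space M. g y \<le> r})"
    by simp
qed

text \<open>The bound \<open>H\<close> on the density is stated without naming a density, because for the
  equilibrium measure it comes from the constraint and not from \<open>\<psi>\<close>.\<close>

locale log_potential = finite_measure M for M :: "real measure" +
  fixes a b H :: real
  assumes sets_M [simp, measurable_cong]: "sets M = sets borel"
    and H_pos: "0 < H"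
    and emeasure_Icc: "emeasure M {a..b} = 1"
    and emeasure_outside: "emeasure M (- {a..b}) = 0"
    and emeasure_le: "A \<in> sets borel \<Longrightarrow> emeasure M A \<le> ennreal H * emeasure lborel A"
begin

definition pot :: "real \<Rightarrow> real" where
  "pot x = (LINT y|M. ln \<bar>x - y\<bar>)"

lemma space_M [simp]: "space M = UNIV"
  using sets_eq_imp_space_eq[OF sets_M] by simp

lemma AE_Icc: "AE y in M. y \<in> {a..b}"
  by (rule AE_I[OF _ emeasure_outside]) auto

lemma measure_UNIV: "measure M UNIV = 1"
proof -
  have "measure M UNIV = measure M {a..b}"
    using AE_Icc by (intro finite_measure_eq_AE) auto
  then show ?thesis by (simp add: measure_def emeasure_Icc)
qed

lemma AE_neq: "AE y in M. y \<noteq> x"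
proof (rule AE_I)
  show "emeasure M {x} = 0"
    using emeasure_le[of "{x}"] by simp
qed auto

lemma measure_lessThan: "measure M {..<x} = measure M {..x}"
  using AE_neq[of x] by (intro finite_measure_eq_AE) (auto elim!: eventually_mono)

lemma nn_integral_le:
  assumes [measurable]: "f \<in> borel_measurable borel"
  shows "(\<integral>\<^sup>+y. f y \<partial>M) \<le> ennreal H * (\<integral>\<^sup>+y. f y \<partial>lborel)"
proof -
  have "(\<integral>\<^sup>+y. f y \<partial>M) \<le> (\<integral>\<^sup>+y. f y \<partial>density lborel (\<lambda>_. ennreal H))"
  proof (rule nn_integral_mono_measure)
    show "M \<le> density lborel (\<lambda>_. ennreal H)"
      by (subst le_measure) (auto simp: emeasure_density_const emeasure_le)
  qed simp
  also have "\<dots> = ennreal H * (\<integral>\<^sup>+y. f y \<partial>lborel)"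
    by (simp add: nn_integral_density nn_integral_cmult)
  finally show ?thesis .
qed

lemma integrable_cutoff:
  assumes "0 < \<epsilon>"
  shows "integrable M (\<lambda>y. ln (max \<bar>x - y\<bar> \<epsilon>))"
proof -
  define B where "B = max (\<bar>x - a\<bar> + \<bar>x - b\<bar>) \<epsilon>"
  have "AE y in M. norm (ln (max \<bar>x - y\<bar> \<epsilon>)) \<le> max \<bar>ln \<epsilon>\<bar> \<bar>ln B\<bar>"
    using AE_Icc
  proof eventually_elim
    case (elim y)
    then have "\<epsilon> \<le> max \<bar>x - y\<bar> \<epsilon>" "max \<bar>x - y\<bar> \<epsilon> \<le> B"
      by (auto simp: B_def)
    then have "ln \<epsilon> \<le> ln (max \<bar>x - y\<bar> \<epsilon>)" "ln (max \<bar>x - y\<bar> \<epsilon>) \<le> ln B"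
      using assms by (simp_all add: less_le_trans)
    then show ?case unfolding real_norm_def by linarith
  qed
  then show ?thesis by (intro integrable_const_bound) auto
qed

text \<open>The singular part has Lebesgue integral at most \<open>2 * \<epsilon>\<close>, and the
  bound on the density multiplies this by \<open>H\<close>. Together with
  \<open>integrable_cutoff\<close> this also yields integrability of the logarithm itself.\<close>

lemma cutoff_error:
  assumes "0 < \<epsilon>"
  shows "integrable M (\<lambda>y. ln (max \<bar>x - y\<bar> \<epsilon>) - ln \<bar>x - y\<bar>)"
    and "(LINT y|M. ln (max \<bar>x - y\<bar> \<epsilon>) - ln \<bar>x - y\<bar>) \<le> 2 * H * \<epsilon>"
    and "0 \<le> (LINT y|M. ln (max \<bar>x - y\<bar> \<epsilon>) - ln \<bar>x - y\<bar>)"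
proof -
  let ?g = "\<lambda>y. ln (max \<bar>x - y\<bar> \<epsilon>) - ln \<bar>x - y\<bar>"
  have "(\<integral>\<^sup>+y. ennreal (?g y) \<partial>M) \<le> ennreal H * (\<integral>\<^sup>+y. ennreal (?g y) \<partial>lborel)"
    by (rule nn_integral_le) measurable
  also have "\<dots> \<le> ennreal H * ennreal (2 * \<epsilon>)"
    by (intro mult_left_mono nn_integral_log_singularity assms) simp
  also have "\<dots> = ennreal (2 * H * \<epsilon>)"
    using H_pos assms by (simp add: ennreal_mult[symmetric] mult_ac)
  finally have le: "(\<integral>\<^sup>+y. ennreal (?g y) \<partial>M) \<le> ennreal (2 * H * \<epsilon>)" .
  have nonneg: "AE y in M. 0 \<le> ?g y"
    using AE_neq[of x] by eventually_elim (auto simp: max_def)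
  show int: "integrable M ?g"
    using le nonneg by (intro integrableI_nonneg) (auto simp: less_top[symmetric] top_unique)
  then have "ennreal (LINT y|M. ?g y) \<le> ennreal (2 * H * \<epsilon>)"
    using le nn_integral_eq_integral[OF int nonneg] by simp
  then show "(LINT y|M. ?g y) \<le> 2 * H * \<epsilon>"
    using H_pos assms by (subst (asm) ennreal_le_iff) auto
  show "0 \<le> (LINT y|M. ?g y)"
    using nonneg by (rule integral_nonneg_AE)
qed

lemma pot_cutoff:
  assumes "0 < \<epsilon>"
  shows "pot x \<le> (LINT y|M. ln (max \<bar>x - y\<bar> \<epsilon>))"
    and "(LINT y|M. ln (max \<bar>x - y\<bar> \<epsilon>)) \<le> pot x + 2 * H * \<epsilon>"
proof -
  have "integrable M (\<lambda>y. ln \<bar>x - y\<bar>)"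
    using Bochner_Integration.integrable_diff[OF integrable_cutoff[OF assms, of x] cutoff_error(1)[OF assms, of x]]
    by simp
  then have "(LINT y|M. ln (max \<bar>x - y\<bar> \<epsilon>) - ln \<bar>x - y\<bar>) = (LINT y|M. ln (max \<bar>x - y\<bar> \<epsilon>)) - pot x"
    using integrable_cutoff[OF assms, of x] by (simp add: pot_def)
  then show "pot x \<le> (LINT y|M. ln (max \<bar>x - y\<bar> \<epsilon>))"
    and "(LINT y|M. ln (max \<bar>x - y\<bar> \<epsilon>)) \<le> pot x + 2 * H * \<epsilon>"
    using cutoff_error(2,3)[OF assms, of x] by linarith+
qed

text \<open>The scale \<open>\<epsilon> = sqrt \<bar>x - y\<bar>\<close> balances two errors: the
  cut-off kernel is Lipschitz with constant \<open>1 / \<epsilon>\<close>, so it moves by at most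
  \<epsilon>, and the cutoff itself costs at most \<open>2 * H * \<epsilon>\<close>. The purpose is
  continuity of the variational derivative.\<close>

lemma pot_Hoelder: "\<bar>pot x - pot y\<bar> \<le> (4 * H + 1) * sqrt \<bar>x - y\<bar>"
proof (cases "x = y")
  case False
  define \<epsilon> where "\<epsilon> = sqrt \<bar>x - y\<bar>"
  have \<epsilon>: "0 < \<epsilon>" "\<epsilon> * \<epsilon> = \<bar>x - y\<bar>" using False by (auto simp: \<epsilon>_def)
  let ?I = "\<lambda>x. LINT y|M. ln (max \<bar>x - y\<bar> \<epsilon>)"
  have ln_le: "ln (max \<bar>u - z\<bar> \<epsilon>) \<le> ln (max \<bar>v - z\<bar> \<epsilon>) + \<epsilon>" if "\<bar>u - v\<bar> = \<epsilon> * \<epsilon>" for u v z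
  proof -
    have "max \<bar>u - z\<bar> \<epsilon> \<le> max \<bar>v - z\<bar> \<epsilon> + \<epsilon> * \<epsilon>"
      using that \<epsilon>(1) by (auto simp: max_def)
    also have "\<dots> \<le> max \<bar>v - z\<bar> \<epsilon> + max \<bar>v - z\<bar> \<epsilon> * \<epsilon>"
      using \<epsilon>(1) by (intro add_left_mono mult_right_mono) auto
    also have "\<dots> = max \<bar>v - z\<bar> \<epsilon> * (1 + \<epsilon>)" by (simp add: algebra_simps)
    also have "\<dots> \<le> max \<bar>v - z\<bar> \<epsilon> * exp \<epsilon>"
      using \<epsilon>(1) by (intro mult_left_mono exp_ge_add_one_self) (auto simp: max_def)
    finally have "ln (max \<bar>u - z\<bar> \<epsilon>) \<le> ln (max \<bar>v - z\<bar> \<epsilon> * exp \<epsilon>)"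
      using \<epsilon>(1) by (subst ln_le_cancel_iff) (auto simp: less_max_iff_disj)
    also have "\<dots> = ln (max \<bar>v - z\<bar> \<epsilon>) + \<epsilon>"
      using \<epsilon>(1) by (subst ln_mult_pos) (auto simp: less_max_iff_disj)
    finally show ?thesis .
  qed
  have "?I u \<le> ?I v + \<epsilon>" if "\<bar>u - v\<bar> = \<epsilon> * \<epsilon>" for u v
  proof -
    have "?I u \<le> (LINT z|M. ln (max \<bar>v - z\<bar> \<epsilon>) + \<epsilon>)"
      using ln_le[OF that] integrable_cutoff[OF \<epsilon>(1)] by (intro integral_mono) auto
    also have "\<dots> = ?I v + \<epsilon>"
      using integrable_cutoff[OF \<epsilon>(1), of v] by (simp add: measure_UNIV)
    finally show ?thesis .
  qed
  from this[of x y] this[of y x] pot_cutoff[OF \<epsilon>(1), of x] pot_cutoff[OF \<epsilon>(1), of y] H_pos \<epsilon>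
  have "\<bar>pot x - pot y\<bar> \<le> 2 * H * \<epsilon> + \<epsilon>"
    by (simp add: abs_le_iff abs_minus_commute)
  also have "\<dots> \<le> (4 * H + 1) * \<epsilon>" using H_pos \<epsilon> by (simp add: algebra_simps)
  finally show ?thesis by (simp add: \<epsilon>_def)
qed simp

lemma isCont_pot: "isCont pot x"
proof -
  have "((\<lambda>y. (4 * H + 1) * sqrt \<bar>y - x\<bar>) \<longlongrightarrow> 0) (at x)"
    by (auto intro!: tendsto_eq_intros)
  then have "((\<lambda>y. pot y - pot x) \<longlongrightarrow> 0) (at x)"
    by (rule Lim_null_comparison[rotated]) (simp add: pot_Hoelder)
  then show ?thesis by (simp add: isCont_def LIM_zero_iff)
qed

text \<open>Both sides are integrals over \<open>r\<close> of the measures of the sublevel sets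
  \<open>{y. ln (max \<bar>x - y\<bar> \<epsilon>) \<le> r}\<close>, which are intervals.\<close>

lemma cutoff_sum_approx:
  assumes Y: "finite Y" "Y \<subseteq> {a..b}" "real (card Y) = \<kappa>" and x: "x \<in> {a..b}"
    and disc: "\<And>r. 0 < r \<Longrightarrow> \<bar>real (card (Y \<inter> {x - r..x + r})) - \<kappa> * measure M {x - r..x + r}\<bar> \<le> D"
    and \<epsilon>: "0 < \<epsilon>" "\<epsilon> \<le> B" "b - a \<le> B"
  shows "\<bar>(\<Sum>y\<in>Y. ln (max \<bar>x - y\<bar> \<epsilon>)) - \<kappa> * (LINT y|M. ln (max \<bar>x - y\<bar> \<epsilon>))\<bar> \<le> D * (ln B - ln \<epsilon>)"
proof -
  interpret Y: finite_measure "count_space Y" 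
    using Y by (intro finite_measureI) simp
  let ?g = "\<lambda>y. ln (max \<bar>x - y\<bar> \<epsilon>)"
  let ?I = "{ln \<epsilon>..ln B}"
  let ?F = "\<lambda>r. measure (count_space Y) {y \<in> space (count_space Y). ?g y \<le> r}"
  let ?G = "\<lambda>r. measure M {y \<in> space M. ?g y \<le> r}"
  have bounds: "ln \<epsilon> \<le> ?g y \<and> ?g y \<le> ln B" if "y \<in> {a..b}" for y
  proof -
    have "\<epsilon> \<le> max \<bar>x - y\<bar> \<epsilon>" "max \<bar>x - y\<bar> \<epsilon> \<le> B"
      using that x \<epsilon> by auto
    then show ?thesis using \<epsilon>(1) by (simp add: less_le_trans)
  qed
  have "\<forall>y\<in>Y. ln \<epsilon> \<le> ?g y \<and> ?g y \<le> ln B" using bounds Y(2) by blast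
  then have F: "(\<Sum>y\<in>Y. ?g y) = ln B * \<kappa> - (LBINT r:?I. ?F r)" "set_integrable lborel ?I ?F"
    using Y.integral_eq_sublevel_integral[of ?g "ln \<epsilon>" "ln B"] Y
    by (auto simp: lebesgue_integral_count_space_finite AE_count_space measure_count_space)
  have "AE y in M. ln \<epsilon> \<le> ?g y \<and> ?g y \<le> ln B"
    using AE_Icc by eventually_elim (rule bounds)
  from integral_eq_sublevel_integral[OF _ this]
  have G: "(LINT y|M. ?g y) = ln B - (LBINT r:?I. ?G r)" "set_integrable lborel ?I ?G"
    by (simp_all add: measure_UNIV)
  have "(\<Sum>y\<in>Y. ?g y) - \<kappa> * (LINT y|M. ?g y) = (LBINT r:?I. \<kappa> * ?G r - ?F r)"
    unfolding F(1) G(1) using F(2) G(2) by (simp add: right_diff_distrib)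
  also have "\<bar>\<dots>\<bar> \<le> (LBINT r:?I. D)"
  proof -
    have int: "set_integrable lborel ?I (\<lambda>r. \<kappa> * ?G r - ?F r)"
      using F(2) G(2) by (intro set_integral_diff set_integrable_mult_right)
    have FG: "\<bar>\<kappa> * ?G r - ?F r\<bar> \<le> D" if "r \<in> ?I" for r
    proof -
      have "ln \<epsilon> \<le> r" using that by simp
      then have "\<epsilon> \<le> exp r" using \<epsilon>(1) by (metis exp_le_cancel_iff exp_ln)
      \<comment> \<open>From level \<open>ln \<epsilon>\<close> upwards the cutoff is invisible: the
        sublevel set is the closed interval of radius \<open>exp r\<close> about \<open>x\<close>,
        the kind of set to which \<open>disc\<close> applies.\<close>
      have eq: "?g y \<le> r \<longleftrightarrow> y \<in> {x - exp r..x + exp r}" for y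
      proof -
        have "?g y \<le> r \<longleftrightarrow> max \<bar>x - y\<bar> \<epsilon> \<le> exp r"
          using \<epsilon>(1) by (metis exp_le_cancel_iff exp_ln less_max_iff_disj)
        then show ?thesis using \<open>\<epsilon> \<le> exp r\<close> by auto
      qed
      have "{y \<in> space M. ?g y \<le> r} = {x - exp r..x + exp r}"
        and "{y \<in> space (count_space Y). ?g y \<le> r} = Y \<inter> {x - exp r..x + exp r}"
        unfolding eq by auto
      then show ?thesis
        using disc[of "exp r"] Y(1) by (simp add: measure_count_space abs_minus_commute del: atLeastAtMost_iff)
    qed
    have "\<bar>LBINT r:?I. \<kappa> * ?G r - ?F r\<bar> \<le> (LBINT r:?I. \<bar>\<kappa> * ?G r - ?F r\<bar>)"
      using set_integral_norm_bound[OF int] by (simp only: real_norm_def)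
    also have "\<dots> \<le> (LBINT r:?I. D)"
    proof (rule set_integral_mono)
      show "set_integrable lborel ?I (\<lambda>r. \<bar>\<kappa> * ?G r - ?F r\<bar>)"
        using int by (rule set_integrable_abs)
      show "set_integrable lborel ?I (\<lambda>r. D)"
        by (simp add: set_integrable_def emeasure_lborel_Icc_eq)
    qed (rule FG)
    finally show ?thesis .
  qed
  also have "\<dots> = D * (ln B - ln \<epsilon>)"
    using \<epsilon> by (simp add: set_lebesgue_integral_def)
  finally show ?thesis .
qed

text \<open>Three errors add up: the discrepancy over intervals, the passage from \<open>pot\<close>
  to its cut-off version, and the possible summand \<open>y = x\<close>, which the cutoff turns into
  \<open>ln \<epsilon>\<close>. By \<open>gap\<close>, the cutoff leaves all other summands
  unchanged.\<close>

lemma log_sum_approx: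
  assumes Y: "finite Y" "Y \<subseteq> {a..b}" "real (card Y) = \<kappa>" and x: "x \<in> {a..b}"
    and disc: "\<And>z. \<bar>real (card (Y \<inter> {..z})) - \<kappa> * measure M {..z}\<bar> \<le> 1"
      "\<And>z. \<bar>real (card (Y \<inter> {..<z})) - \<kappa> * measure M {..z}\<bar> \<le> 1"
    and gap: "\<And>y. y \<in> Y - {x} \<Longrightarrow> \<epsilon> \<le> \<bar>x - y\<bar>"
    and \<epsilon>: "0 < \<epsilon>" "\<epsilon> \<le> B" "b - a \<le> B"
  shows "\<bar>(\<Sum>y\<in>Y - {x}. ln \<bar>x - y\<bar>) - \<kappa> * pot x\<bar> \<le> 2 * (ln B - ln \<epsilon>) + \<bar>ln \<epsilon>\<bar> + 2 * \<kappa> * H * \<epsilon>"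
proof -
  let ?g = "\<lambda>y. ln (max \<bar>x - y\<bar> \<epsilon>)"
  have "\<bar>(\<Sum>y\<in>Y. ?g y) - \<kappa> * (LINT y|M. ?g y)\<bar> \<le> 2 * (ln B - ln \<epsilon>)"
  proof (rule cutoff_sum_approx[OF Y x _ \<epsilon>])
    fix r :: real assume "0 < r"
    \<comment> \<open>A closed interval is a closed half-line minus an open one, hence the two forms
      of \<open>disc\<close> and the discrepancy 2. The measure has no atoms, so it does not
      distinguish the two kinds of half-line.\<close>
    have "card (Y \<inter> {..x + r}) = card (Y \<inter> {..<x - r}) + card (Y \<inter> {x - r..x + r})"
      using Y(1) \<open>0 < r\<close> by (subst card_Un_disjoint[symmetric]) (auto intro!: arg_cong[where f = card])
    moreover have "measure M {..x + r} = measure M {..<x - r} + measure M {x - r..x + r}"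
      using \<open>0 < r\<close> by (subst finite_measure_Union[symmetric]) (auto intro!: arg_cong[where f = "measure M"])
    ultimately have "real (card (Y \<inter> {x - r..x + r})) - \<kappa> * measure M {x - r..x + r}
      = (real (card (Y \<inter> {..x + r})) - \<kappa> * measure M {..x + r})
        - (real (card (Y \<inter> {..<x - r})) - \<kappa> * measure M {..x - r})"
      by (simp add: measure_lessThan algebra_simps)
    then show "\<bar>real (card (Y \<inter> {x - r..x + r})) - \<kappa> * measure M {x - r..x + r}\<bar> \<le> 2"
      using disc(1)[of "x + r"] disc(2)[of "x - r"] by linarith
  qed
  moreover have "\<bar>\<kappa> * (LINT y|M. ?g y) - \<kappa> * pot x\<bar> \<le> 2 * \<kappa> * H * \<epsilon>"
  proof -
    have "\<bar>(LINT y|M. ?g y) - pot x\<bar> \<le> 2 * H * \<epsilon>"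
      using pot_cutoff[OF \<epsilon>(1), of x] by linarith
    then have "\<kappa> * \<bar>(LINT y|M. ?g y) - pot x\<bar> \<le> \<kappa> * (2 * H * \<epsilon>)"
      using Y(3) by (intro mult_left_mono) auto
    then show ?thesis
      using Y(3) by (simp add: right_diff_distrib[symmetric] abs_mult mult_ac)
  qed
  moreover have "\<bar>(\<Sum>y\<in>Y. ?g y) - (\<Sum>y\<in>Y - {x}. ln \<bar>x - y\<bar>)\<bar> \<le> \<bar>ln \<epsilon>\<bar>"
  proof -
    have "(\<Sum>y\<in>Y - {x}. ?g y) = (\<Sum>y\<in>Y - {x}. ln \<bar>x - y\<bar>)"
      using gap by (intro sum.cong) (auto simp: max_absorb1)
    then show ?thesis
      using Y(1) \<epsilon>(1) by (cases "x \<in> Y") (auto simp: sum.remove[of Y x] max_def)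
  qed
  ultimately show ?thesis by linarith
qed

end

lemma log_potentialI:
  assumes sets: "sets M = sets borel" and rest: "0 < H" "emeasure M {a..b} = 1" "emeasure M (- {a..b}) = 0"
    "\<And>A. A \<in> sets borel \<Longrightarrow> emeasure M A \<le> ennreal H * emeasure lborel A"
  shows "log_potential M a b H"
proof -
  have space: "space M = {a..b} \<union> (- {a..b})"
    using sets_eq_imp_space_eq[OF sets] by simp
  have "emeasure M (space M) \<le> emeasure M {a..b} + emeasure M (- {a..b})"
    unfolding space by (rule emeasure_subadditive) (simp_all add: sets)
  then interpret finite_measure M
    using rest by (intro finite_measureI) (auto simp: top_unique)
  show ?thesis
    by standard (use assms in auto)
qed

section \<open>Discretizing a measure by nodes\<close>

lemma card_increases:
  fixes f :: "nat \<Rightarrow> nat"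
  assumes "f 0 = 0" and "\<And>j. j < m \<Longrightarrow> f j \<le> f (Suc j) \<and> f (Suc j) \<le> Suc (f j)"
  shows "card {j. j < m \<and> f j < f (Suc j)} = f m"
  using assms(2)
proof (induction m)
  case 0
  then show ?case using assms(1) by simp
next
  case (Suc m)
  have "{j. j < Suc m \<and> f j < f (Suc j)}
    = {j. j < m \<and> f j < f (Suc j)} \<union> (if f m < f (Suc m) then {m} else {})"
    by (auto simp: less_Suc_eq)
  moreover have "card {j. j < m \<and> f j < f (Suc j)} = f m"
    using Suc by (meson less_Suc_eq)
  moreover have "f m \<le> f (Suc m)" "f (Suc m) \<le> Suc (f m)"
    using Suc.prems[of m] by auto
  ultimately show ?case by auto
qed

text \<open>The points where the rounded-up distribution function \<open>\<lceil>g\<rceil>\<close> increases along the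
  sequence \<open>x\<close>.\<close>

lemma subset_with_distribution:
  fixes x :: "nat \<Rightarrow> real" and g :: "real \<Rightarrow> real"
  assumes "0 < N"
    and x: "\<And>i j. i < j \<Longrightarrow> j < N \<Longrightarrow> x i < x j"
    and g: "mono g" "\<And>z. 0 \<le> g z" "\<And>z. g z \<le> real \<kappa>"
    and first: "g (x 0) \<le> 1"
    and step: "\<And>j. Suc j < N \<Longrightarrow> g (x (Suc j)) \<le> g (x j) + 1"
    and last: "real \<kappa> < g (x (N - 1)) + 1"
  obtains Y where "Y \<subseteq> x ` {..<N}" "card Y = \<kappa>"
    "\<And>z. \<bar>real (card (Y \<inter> {..z})) - g z\<bar> \<le> 1"
    "\<And>z. \<bar>real (card (Y \<inter> {..<z})) - g z\<bar> \<le> 1"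
    "\<And>j. j < N \<Longrightarrow> x j \<in> Y \<Longrightarrow> 0 < g (x j) \<and> (0 < j \<longrightarrow> g (x (j - 1)) < g (x j))"
proof -
  \<comment> \<open>\<open>f j\<close> is the number of points to be chosen among the first
    \<open>j\<close>. The shift by one, with \<open>f 0 = 0\<close>, subjects the first point to the
    same rule as the others.\<close>
  define f where "f j = (if j = 0 then 0 else nat \<lceil>g (x (j - 1))\<rceil>)" for j
  define Y where "Y = x ` {j. j < N \<and> f j < f (Suc j)}"
  have f_Suc: "g (x j) \<le> real (f (Suc j))" "real (f (Suc j)) < g (x j) + 1" for j
    using g(2)[of "x j"] ceiling_correct[of "g (x j)"] by (auto simp: f_def)
  have f_step: "f j \<le> f (Suc j) \<and> f (Suc j) \<le> Suc (f j)" if "j < N" for j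
  proof (cases j)
    case 0
    then show ?thesis using f_Suc[of 0] first by (simp add: f_def[of 0])
  next
    case (Suc i)
    then have "x i \<le> x j" using x[of i j] that by simp
    then have "g (x i) \<le> g (x j)" using g(1) by (auto dest: monoD)
    moreover have "g (x j) \<le> g (x i) + 1" using step[of i] that Suc by simp
    ultimately show ?thesis
      using f_Suc[of i] f_Suc[of j] Suc by (simp add: f_def nat_mono ceiling_mono) linarith
  qed
  \<comment> \<open>By \<open>last\<close>, the final value of \<open>g\<close> exceeds \<kappa> by
    more than -1; as it is at most \<kappa>, its ceiling is exactly \<kappa>.\<close>
  have fN: "f N = \<kappa>"
  proof -
    obtain n where n: "N = Suc n" using \<open>0 < N\<close> gr0_implies_Suc by blast
    then show ?thesis using f_Suc[of n] last g(3)[of "x n"] by simp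
  qed
  have inj: "inj_on x {..<N}"
    by (rule linorder_inj_onI') (use x in force)
  have card: "card (x ` {j. j < m \<and> f j < f (Suc j)}) = f m" if "m \<le> N" for m
  proof -
    have "card (x ` {j. j < m \<and> f j < f (Suc j)}) = card {j. j < m \<and> f j < f (Suc j)}"
      using that by (intro card_image inj_on_subset[OF inj]) auto
    also have "\<dots> = f m"
      using f_step that by (intro card_increases) (auto simp: f_def[of 0])
    finally show ?thesis .
  qed
  \<comment> \<open>\<open>S\<close> stands for the closed and the open half-line ending at
    \<open>z\<close> simultaneously. Below, \<open>m\<close> is the first index outside
    \<open>S\<close> (or \<open>N\<close>), so exactly the indices below \<open>m\<close> give
    points of \<open>S\<close>.\<close>
  have disc: "\<bar>real (card (Y \<inter> S)) - g z\<bar> \<le> 1"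
    if S: "\<And>y. y < z \<Longrightarrow> y \<in> S" "\<And>y. z < y \<Longrightarrow> y \<notin> S" for S z
  proof -
    define m where "m = (LEAST j. j = N \<or> x j \<notin> S)"
    have m: "m = N \<or> x m \<notin> S" and before: "\<And>j. j < m \<Longrightarrow> j \<noteq> N \<and> x j \<in> S"
      unfolding m_def by (rule LeastI_ex, blast) (use not_less_Least in blast)
    have "m \<le> N" by (rule ccontr) (use before[of N] in auto)
    have "x j \<in> S \<longleftrightarrow> j < m" if "j < N" for j
    proof
      assume "x j \<in> S"
      show "j < m"
      proof (rule ccontr)
        assume "\<not> j < m"
        then have "x m \<notin> S" "m \<noteq> j" using m that \<open>x j \<in> S\<close> by auto
        then have "x m < x j" using x[of m j] that \<open>\<not> j < m\<close> by auto
        moreover have "x j \<le> z" using S(2)[of "x j"] \<open>x j \<in> S\<close> by (cases "z < x j") auto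
        moreover have "z \<le> x m" using S(1)[of "x m"] \<open>x m \<notin> S\<close> by (cases "x m < z") auto
        ultimately show False by simp
      qed
    qed (use before in auto)
    then have "Y \<inter> S = x ` {j. j < m \<and> f j < f (Suc j)}"
      using \<open>m \<le> N\<close> by (auto simp: Y_def)
    then have card_m: "card (Y \<inter> S) = f m" using card \<open>m \<le> N\<close> by simp
    have upper: "z \<le> x m" if "m < N" using m that S(1)[of "x m"] by (cases "x m < z") auto
    show ?thesis
    proof (cases m)
      case 0
      then have "g z \<le> g (x 0)" using upper \<open>0 < N\<close> by (intro monoD[OF g(1)]) simp
      then have "g z \<le> 1" using first by simp
      then show ?thesis using 0 card_m g(2)[of z] by (simp add: f_def)
    next
      case (Suc i)
      have "x i \<le> z" using before[of i] S(2)[of "x i"] Suc by (cases "z < x i") auto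
      then have "g (x i) \<le> g z" using g(1) by (auto dest: monoD)
      \<comment> \<open>If a point \<open>x m\<close> remains, it lies at or beyond \<open>z\<close>
        and \<open>g\<close> gains at most 1 on the way there; otherwise \<open>f m\<close> is
        already \<kappa>.\<close>
      moreover have "g z \<le> real (f m) + 1"
      proof (cases "m < N")
        case True
        then have "g z \<le> g (x m)" using upper g(1) by (auto dest: monoD)
        then show ?thesis using step[of i] f_Suc(1)[of i] True Suc by simp
      next
        case False
        then show ?thesis using g(3)[of z] fN \<open>m \<le> N\<close> by simp
      qed
      ultimately show ?thesis using card_m f_Suc(2)[of i] Suc by simp
    qed
  qed
  show ?thesis
  proof
    show "Y \<subseteq> x ` {..<N}" by (auto simp: Y_def)
    show "card Y = \<kappa>" using card[of N] fN by (simp add: Y_def)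
    show "\<bar>real (card (Y \<inter> {..z})) - g z\<bar> \<le> 1" "\<bar>real (card (Y \<inter> {..<z})) - g z\<bar> \<le> 1" for z
      by (intro disc; simp)+
    show "0 < g (x j) \<and> (0 < j \<longrightarrow> g (x (j - 1)) < g (x j))" if "j < N" "x j \<in> Y" for j
    proof -
      \<comment> \<open>A point is chosen only where the ceiling rises, and this forces
        \<open>g\<close> itself to exceed its value at the previous point, or 0 at the first
        point.\<close>
      have "f j < f (Suc j)"
        using that inj by (auto simp: Y_def inj_on_def)
      then have f: "f j < nat \<lceil>g (x j)\<rceil>" by (simp add: f_def[of "Suc j"])
      then have "0 < g (x j)" by (cases "g (x j) \<le> 0") (auto simp: not_le)
      moreover have "g (x (j - 1)) < g (x j)" if "0 < j"
      proof (rule ccontr)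
        assume "\<not> g (x (j - 1)) < g (x j)"
        then have "nat \<lceil>g (x j)\<rceil> \<le> nat \<lceil>g (x (j - 1))\<rceil>" by (intro nat_mono ceiling_mono) simp
        then show False using f that by (simp only: f_def not_less[symmetric] split: if_splits) simp
      qed
      ultimately show ?thesis by blast
    qed
  qed
qed

section \<open>Nodes as quantiles of the density\<close>

locale node_setting =
  fixes a b h H :: real and \<rho> :: "real \<Rightarrow> real" and x :: "nat \<Rightarrow> nat \<Rightarrow> real"
  assumes a_less_b: "a < b"
    and h_pos: "0 < h"
    and \<rho>_bounds: "\<And>t. t \<in> {a..b} \<Longrightarrow> h \<le> \<rho> t \<and> \<rho> t \<le> H"
    and \<rho>_cont: "continuous_on {a..b} \<rho>"
    and \<rho>_total: "(LBINT t:{a..b}. \<rho> t) = 1"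
    and node_system: "node_system a b \<rho> x"
begin

definition node_measure :: "real measure" where
  "node_measure = density lborel (\<lambda>t. ennreal (indicat_real {a..b} t * \<rho> t))"

lemma H_pos: "0 < H"
  using \<rho>_bounds[of a] h_pos a_less_b by simp

lemma \<rho>_measurable [measurable]: "(\<lambda>t. indicat_real {a..b} t * \<rho> t) \<in> borel_measurable borel"
  using borel_measurable_continuous_on_indicator[OF _ \<rho>_cont] by simp

lemma \<rho>_nonneg: "0 \<le> indicat_real {a..b} t * \<rho> t"
  using \<rho>_bounds[of t] h_pos by (auto simp: indicator_def)

lemma sets_node_measure [simp, measurable_cong]: "sets node_measure = sets borel"
  by (simp add: node_measure_def)

lemma emeasure_node_measure:
  "A \<in> sets borel \<Longrightarrow>
    emeasure node_measure A = (\<integral>\<^sup>+t. ennreal (indicat_real {a..b} t * \<rho> t) * indicator A t \<partial>lborel)"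
  by (simp add: node_measure_def emeasure_density)

lemma emeasure_node_measure_Icc:
  assumes "{u..v} \<subseteq> {a..b}"
  shows "emeasure node_measure {u..v} = ennreal (LBINT t:{u..v}. \<rho> t)"
proof -
  have int: "set_integrable lborel {u..v} \<rho>"
    using assms \<rho>_cont by (intro borel_integrable_atLeastAtMost' continuous_on_subset[OF \<rho>_cont])
  have "emeasure node_measure {u..v} = (\<integral>\<^sup>+t. ennreal (indicat_real {u..v} t * \<rho> t) \<partial>lborel)"
    using assms by (auto simp: emeasure_node_measure indicator_def intro!: nn_integral_cong)
  also have "\<dots> = ennreal (LINT t|lborel. indicat_real {u..v} t * \<rho> t)"
  proof (rule nn_integral_eq_integral)
    show "integrable lborel (\<lambda>t. indicat_real {u..v} t * \<rho> t)"
      using int by (simp add: set_integrable_def)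
    have "0 \<le> indicat_real {u..v} t * \<rho> t" for t
      using \<rho>_nonneg[of t] assms by (auto simp: indicator_def split: if_splits)
    then show "AE t in lborel. 0 \<le> indicat_real {u..v} t * \<rho> t" by simp
  qed
  finally show ?thesis by (simp add: set_lebesgue_integral_def)
qed

lemma emeasure_node_measure_total: "emeasure node_measure {a..b} = 1"
  by (simp add: emeasure_node_measure_Icc \<rho>_total)

lemma emeasure_node_measure_outside: "emeasure node_measure (- {a..b}) = 0"
proof (subst emeasure_node_measure)
  have "(\<integral>\<^sup>+t\<in>- {a..b}. ennreal (indicat_real {a..b} t * \<rho> t) \<partial>lborel) = (\<integral>\<^sup>+(t::real). 0 \<partial>lborel)"
    by (intro nn_integral_cong) (auto simp: indicator_def)
  then show "(\<integral>\<^sup>+t\<in>- {a..b}. ennreal (indicat_real {a..b} t * \<rho> t) \<partial>lborel) = 0"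
    by simp
qed simp

lemma emeasure_node_measure_le:
  assumes "A \<in> sets borel"
  shows "emeasure node_measure A \<le> ennreal H * emeasure lborel A"
proof -
  have "emeasure node_measure A \<le> (\<integral>\<^sup>+t. ennreal H * indicator A t \<partial>lborel)"
    unfolding emeasure_node_measure[OF assms] using \<rho>_bounds H_pos
    by (auto simp: indicator_def intro!: nn_integral_mono ennreal_leI)
  then show ?thesis using assms by (simp add: nn_integral_cmult_indicator)
qed

sublocale node: log_potential node_measure a b H
  using H_pos emeasure_node_measure_total emeasure_node_measure_outside emeasure_node_measure_le
  by (intro log_potentialI) auto

lemma pot_eq: "node.pot z = (LBINT y:{a..b}. ln \<bar>z - y\<bar> * \<rho> y)"
proof -
  have "node.pot z = (LINT y|lborel. (indicat_real {a..b} y * \<rho> y) * ln \<bar>z - y\<bar>)"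
    unfolding node.pot_def unfolding node_measure_def using \<rho>_nonneg
    by (subst integral_real_density) auto
  then show ?thesis by (simp add: set_lebesgue_integral_def mult_ac)
qed

lemma measure_Icc_ge:
  assumes "{u..v} \<subseteq> {a..b}" "u \<le> v"
  shows "h * (v - u) \<le> measure node_measure {u..v}"
proof -
  have "ennreal (h * (v - u)) = (\<integral>\<^sup>+t. ennreal h * indicator {u..v} t \<partial>lborel)"
    using assms h_pos by (simp add: nn_integral_cmult_indicator ennreal_mult)
  also have "\<dots> \<le> emeasure node_measure {u..v}"
    using assms \<rho>_bounds
    by (auto simp: emeasure_node_measure indicator_def subset_eq intro!: nn_integral_mono ennreal_leI)
  finally show ?thesis
    by (simp add: node.emeasure_eq_measure)
qed

lemma measure_Icc_le:
  assumes "u \<le> v"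
  shows "measure node_measure {u..v} \<le> H * (v - u)"
  using node.emeasure_le[of "{u..v}"] assms H_pos
  by (simp add: node.emeasure_eq_measure ennreal_mult[symmetric])

lemma node_in: "j < N \<Longrightarrow> x N j \<in> {a<..<b}"
  using node_system by (auto simp: node_system_def)

lemma measure_atMost_node:
  assumes "j < N"
  shows "measure node_measure {..x N j} = (2 * real j + 1) / (2 * real N)"
proof -
  have "measure node_measure {..x N j} = measure node_measure {a..x N j}"
    using node.AE_Icc by (intro node.finite_measure_eq_AE) (auto elim!: eventually_mono)
  also have "\<dots> = (LBINT t:{a..x N j}. \<rho> t)"
  proof -
    have "0 \<le> (LBINT t:{a..x N j}. \<rho> t)"
      using node_system assms by (auto simp: node_system_def)
    then show ?thesis
      using emeasure_node_measure_Icc[of a "x N j"] node_in[OF assms]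
      by (simp add: node.emeasure_eq_measure)
  qed
  finally show ?thesis using node_system assms by (auto simp: node_system_def)
qed

lemma node_less:
  assumes "i < j" "j < N"
  shows "x N i < x N j"
proof (rule ccontr)
  assume "\<not> x N i < x N j"
  then have "measure node_measure {..x N j} \<le> measure node_measure {..x N i}"
    by (intro node.finite_measure_mono) auto
  then show False
    using assms by (simp add: measure_atMost_node field_simps)
qed

lemma measure_between_nodes:
  assumes "i < j" "j < N"
  shows "measure node_measure {x N i<..x N j} = (real j - real i) / real N"
proof -
  have "measure node_measure {..x N j} = measure node_measure {..x N i} + measure node_measure {x N i<..x N j}"
    using node_less[OF assms]
    by (subst node.finite_measure_Union[symmetric]) (auto intro!: arg_cong[where f = "measure node_measure"])
  then show ?thesis
    using assms by (simp add: measure_atMost_node field_simps)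
qed

text \<open>The mass between two distinct nodes is at least \<open>1 / N\<close>, and the upper
  bound \<open>H\<close> on the density converts mass into length.\<close>

lemma node_gap:
  assumes "i < N" "j < N" "i \<noteq> j"
  shows "1 / (H * real N) \<le> \<bar>x N i - x N j\<bar>"
proof -
  have "1 / (H * real N) \<le> x N j - x N i" if "i < j" "j < N" for i j
  proof -
    have "1 \<le> real j - real i" using that(1) by linarith
    then have "1 / real N \<le> (real j - real i) / real N"
      by (rule divide_right_mono) simp
    also have "\<dots> = measure node_measure {x N i<..x N j}"
      by (rule measure_between_nodes[OF that, symmetric])
    also have "\<dots> \<le> measure node_measure {x N i..x N j}"
      by (rule node.finite_measure_mono) auto
    also have "\<dots> \<le> H * (x N j - x N i)"
      using node_less[OF that] by (intro measure_Icc_le) auto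
    finally show ?thesis using H_pos that by (simp add: field_simps)
  qed
  from this[of i j] this[of j i] assms show ?thesis by (cases "i < j") auto
qed

text \<open>The mass between neighbours is \<open>1 / N\<close>, and \<open>1 / (2 * N)\<close>
  before the first node; here the lower bound \<open>h\<close> converts mass into length. The
  endpoint \<open>a\<close> plays the predecessor of the first node, here and in
  \<open>discretization\<close>.\<close>

lemma node_close:
  assumes "j < N"
  shows "x N j - (if j = 0 then a else x N (j - 1)) \<le> 1 / (h * real N)"
proof -
  let ?u = "if j = 0 then a else x N (j - 1)"
  have u: "a \<le> ?u" "?u \<le> x N j" "x N j \<le> b"
    using node_in[of j N] node_in[of "j - 1" N] node_less[of "j - 1" j N] assms
    by (auto split: if_splits simp: less_imp_le)
  have "h * (x N j - ?u) \<le> measure node_measure {?u..x N j}"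
    using u by (intro measure_Icc_ge) auto
  also have "\<dots> \<le> 1 / real N"
  proof (cases "j = 0")
    case True
    have "measure node_measure {a..x N j} \<le> measure node_measure {..x N j}"
      by (intro node.finite_measure_mono) auto
    then show ?thesis using True assms by (simp add: measure_atMost_node field_simps)
  next
    case False
    have "measure node_measure {x N (j - 1)..x N j} = measure node_measure {x N (j - 1)<..x N j}"
      using node.AE_neq[of "x N (j - 1)"]
      by (intro node.finite_measure_eq_AE) (auto elim!: eventually_mono)
    then show ?thesis using False assms by (simp add: measure_between_nodes of_nat_diff)
  qed
  finally show ?thesis using h_pos assms by (simp add: field_simps)
qed

lemma inj_on_nodes: "inj_on (x N) {..<N}"
  by (rule linorder_inj_onI') (use node_less in force)

lemma card_nodes: "card (nodes x N) = N"
  by (simp add: nodes_def card_image[OF inj_on_nodes])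

text \<open>Domination by the node measure bounds the growth of
  \<open>\<kappa> * measure M {..z}\<close>: at most 1 between consecutive nodes, and at most
  \<open>1 / 2\<close> before the first and after the last node. These are the hypotheses of
  \<open>subset_with_distribution\<close>. The final property will place the chosen nodes close to
  the support of \<open>M\<close>.\<close>

lemma discretization:
  fixes M :: "real measure"
  assumes M: "log_potential M a b H'" and "0 < N"
    and le: "\<And>A. A \<in> sets borel \<Longrightarrow> real \<kappa> * measure M A \<le> real N * measure node_measure A"
  obtains Y where "Y \<subseteq> nodes x N" "card Y = \<kappa>"
    "\<forall>z. \<bar>real (card (Y \<inter> {..z})) - real \<kappa> * measure M {..z}\<bar> \<le> 1"
    "\<forall>z. \<bar>real (card (Y \<inter> {..<z})) - real \<kappa> * measure M {..z}\<bar> \<le> 1"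
    "\<forall>j<N. x N j \<in> Y \<longrightarrow> 0 < measure M {(if j = 0 then a else x N (j - 1))<..<x N j}"
proof -
  interpret M: log_potential M a b H' by fact
  define g where "g z = real \<kappa> * measure M {..z}" for z
  have split: "measure M {..v} = measure M {..u} + measure M {u<..v}" if "u \<le> v" for u v
    using that by (subst M.finite_measure_Union[symmetric]) (auto intro!: arg_cong[where f = "measure M"])
  have first: "g (x N 0) \<le> 1"
    using le[of "{..x N 0}"] \<open>0 < N\<close> by (simp add: g_def measure_atMost_node)
  have step: "g (x N (Suc j)) \<le> g (x N j) + 1" if "Suc j < N" for j
    using le[of "{x N j<..x N (Suc j)}"] split[of "x N j" "x N (Suc j)"] node_less[of j "Suc j" N] that
    by (simp add: g_def measure_between_nodes distrib_left)
  have last: "real \<kappa> < g (x N (N - 1)) + 1"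
  proof -
    have compl: "measure M' {x N (N - 1)<..} = 1 - measure M' {..x N (N - 1)}"
      if "log_potential M' a b H''" for M' H''
    proof -
      interpret M': log_potential M' a b H'' by fact
      have "- {..x N (N - 1)} = {x N (N - 1)<..}" by auto
      then show ?thesis
        using M'.finite_measure_compl[of "{..x N (N - 1)}"] by (simp add: M'.measure_UNIV Compl_eq_Diff_UNIV)
    qed
    have "real \<kappa> - g (x N (N - 1)) = real \<kappa> * measure M {x N (N - 1)<..}"
      unfolding compl[OF M] g_def by (simp add: right_diff_distrib)
    also have "\<dots> \<le> real N * measure node_measure {x N (N - 1)<..}"
      by (rule le) auto
    also have "\<dots> = 1 / 2"
      using compl[OF node.log_potential_axioms] \<open>0 < N\<close>
      by (simp add: measure_atMost_node of_nat_diff field_simps)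
    finally show ?thesis by simp
  qed
  have mono: "mono g"
    unfolding g_def by (intro monoI mult_left_mono M.finite_measure_mono) auto
  have le_\<kappa>: "g z \<le> real \<kappa>" for z
    using M.bounded_measure[of "{..z}"] by (simp add: g_def M.measure_UNIV mult_left_le)
  have g_nonneg: "0 \<le> g z" for z by (simp add: g_def)
  show ?thesis
  proof (rule subset_with_distribution[of N "x N" g \<kappa>,
          OF \<open>0 < N\<close> node_less mono g_nonneg le_\<kappa> first step last])
    fix Y
    assume Y: "Y \<subseteq> x N ` {..<N}" "card Y = \<kappa>"
      "\<And>z. \<bar>real (card (Y \<inter> {..z})) - g z\<bar> \<le> 1" "\<And>z. \<bar>real (card (Y \<inter> {..<z})) - g z\<bar> \<le> 1"
      "\<And>j. j < N \<Longrightarrow> x N j \<in> Y \<Longrightarrow> 0 < g (x N j) \<and> (0 < j \<longrightarrow> g (x N (j - 1)) < g (x N j))"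
    have support: "0 < measure M {(if j = 0 then a else x N (j - 1))<..<x N j}" if j: "j < N" "x N j \<in> Y" for j
    proof -
    let ?u = "if j = 0 then a else x N (j - 1)"
    have "0 < measure M {?u<..x N j}"
    proof (cases "j = 0")
      case True
      have "measure M {..x N j} = measure M {a<..x N j}"
        using M.AE_Icc M.AE_neq[of a] by (intro M.finite_measure_eq_AE) (auto elim!: eventually_elim2)
      then show ?thesis using True Y(5)[OF j] by (auto simp: g_def zero_less_mult_iff)
    next
      case False
      then have "g (x N j) - g (x N (j - 1)) = real \<kappa> * measure M {x N (j - 1)<..x N j}"
        using split[of "x N (j - 1)" "x N j"] node_less[of "j - 1" j N] j by (simp add: g_def algebra_simps)
      moreover have "g (x N (j - 1)) < g (x N j)" using False Y(5)[OF j] by blast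
      ultimately have "0 < real \<kappa> * measure M {x N (j - 1)<..x N j}" by linarith
      then show ?thesis using False by (auto simp: zero_less_mult_iff)
    qed
    also have "measure M {?u<..x N j} = measure M {?u<..<x N j}"
      using M.AE_neq[of "x N j"] by (intro M.finite_measure_eq_AE) (auto elim!: eventually_mono)
    finally show ?thesis .
    qed
    show ?thesis
      by (rule that[of Y]) (use Y support in \<open>auto simp: nodes_def g_def\<close>)
  qed
qed

end

section \<open>The equilibrium measure\<close>

text \<open>The union of all admissible subintervals through \<open>z\<close> is again an interval.
  This is needed because the variational conditions speak only of maximal bands and saturated
  regions, whereas the density is analysed near a single point.\<close>

lemma maximal_subinterval_exists:
  assumes J: "open_subinterval a b J" "z \<in> J" "\<forall>t\<in>J. Q t"
  obtains I where "maximal_subinterval a b (\<lambda>I. \<forall>t\<in>I. Q t) I" "z \<in> I"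
proof -
  define \<J> where "\<J> = {J. open_subinterval a b J \<and> z \<in> J \<and> (\<forall>t\<in>J. Q t)}"
  define W where "W = \<Union>\<J>"
  have interval: "\<exists>p q. a \<le> p \<and> p < q \<and> q \<le> b \<and> J = {p<..<q}" if "J \<in> \<J>" for J
    using that by (auto simp: \<J>_def open_subinterval_def)
  have W_le: "W \<subseteq> {a<..<b}"
    using interval by (force simp: W_def)
  have "z \<in> W" using J by (auto simp: W_def \<J>_def)
  have bdd: "bdd_below W" "bdd_above W"
    using W_le by (meson bdd_below_mono bdd_below_Ioo bdd_above_mono bdd_above_Ioo)+
  have W_eq: "W = {Inf W<..<Sup W}"
  proof (intro equalityI subsetI)
    fix y assume "y \<in> W"
    then obtain J where "J \<in> \<J>" "y \<in> J" by (auto simp: W_def)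
    then obtain p q where pq: "J = {p<..<q}" using interval by blast
    have "{p<..<q} \<subseteq> W" using \<open>J \<in> \<J>\<close> pq by (auto simp: W_def)
    moreover have "(p + y) / 2 \<in> {p<..<q}" "(y + q) / 2 \<in> {p<..<q}"
      using \<open>y \<in> J\<close> pq by auto
    ultimately have "Inf W \<le> (p + y) / 2" "(y + q) / 2 \<le> Sup W"
      using bdd by (blast intro: cInf_lower cSup_upper)+
    then show "y \<in> {Inf W<..<Sup W}"
      using \<open>y \<in> J\<close> pq by auto
  next
    fix y assume y: "y \<in> {Inf W<..<Sup W}"
    have "W \<noteq> {}" using \<open>z \<in> W\<close> by blast
    obtain v where v: "v \<in> W" "v < y" using cInf_lessD[OF \<open>W \<noteq> {}\<close>, of y] y by auto
    obtain w where w: "w \<in> W" "y < w" using less_cSupD[OF \<open>W \<noteq> {}\<close>, of y] y by auto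
    \<comment> \<open>Both intervals contain \<open>z\<close>; hence \<open>y\<close>, lying between
      \<open>v\<close> and \<open>w\<close>, lies between \<open>v\<close> and \<open>z\<close> in
      \<open>J1\<close> or between \<open>z\<close> and \<open>w\<close> in
      \<open>J2\<close>.\<close>
    obtain J1 J2 where J12: "J1 \<in> \<J>" "v \<in> J1" "J2 \<in> \<J>" "w \<in> J2"
      using v(1) w(1) by (auto simp: W_def)
    then have "z \<in> J1" "z \<in> J2" by (auto simp: \<J>_def)
    moreover obtain p1 q1 p2 q2 where "J1 = {p1<..<q1}" "J2 = {p2<..<q2}"
      using interval J12 by meson
    ultimately have "y \<in> J1 \<or> y \<in> J2" using v(2) w(2) J12 by auto
    then show "y \<in> W" using J12 by (auto simp: W_def)
  qed
  have "a \<le> Inf W" "Sup W \<le> b"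
    using W_le \<open>z \<in> W\<close> by (auto intro!: cInf_greatest cSup_least)
  moreover have "Inf W < Sup W"
    using \<open>z \<in> W\<close> by (subst (asm) W_eq) auto
  ultimately have "open_subinterval a b W"
    unfolding open_subinterval_def using W_eq by blast
  then have "maximal_subinterval a b (\<lambda>I. \<forall>t\<in>I. Q t) W"
    unfolding maximal_subinterval_def using \<open>z \<in> W\<close> by (auto simp: W_def \<J>_def)
  then show ?thesis using that \<open>z \<in> W\<close> by blast
qed

locale equilibrium_setting = node_setting a b h H \<rho> x
  for a b h H :: real and \<rho> :: "real \<Rightarrow> real" and x :: "nat \<Rightarrow> nat \<Rightarrow> real" +
  fixes c ell :: real and \<mu> :: "real measure" and \<psi> :: "real \<Rightarrow> real" and V :: "complex \<Rightarrow> complex"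
  assumes c: "0 < c" "c < 1"
    and admissible: "admissible a b \<rho> c \<mu>"
    and density: "continuous_density a b \<mu> \<psi>"
    and variational: "strict_variational_conditions a b \<rho> V c \<mu> \<psi> ell"
    and V_cont: "continuous_on {a..b} (\<lambda>t. Re (V (complex_of_real t)))"
begin

lemma sets_\<mu>: "sets \<mu> = sets (restrict_space borel {a..b})"
  using admissible by (simp add: admissible_def)

lemma space_\<mu>: "space \<mu> = {a..b}"
  using sets_eq_imp_space_eq[OF sets_\<mu>] by (simp add: space_restrict_space)

lemma id_measurable [measurable]: "(\<lambda>t. t) \<in> measurable \<mu> borel"
  unfolding measurable_cong_sets[OF sets_\<mu> refl] by (rule measurable_restrict_space1) simp

text \<open>The measure \<mu> lives on \<open>{a..b}\<close>; its image on the line has the same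
  sigma-algebra as \<open>node_measure\<close> and fits \<open>log_potential\<close>.\<close>

definition eq_measure :: "real measure" where
  "eq_measure = distr \<mu> borel (\<lambda>t. t)"

lemma emeasure_eq_measure:
  assumes "A \<in> sets borel"
  shows "emeasure eq_measure A = emeasure \<mu> (A \<inter> {a..b})"
  unfolding eq_measure_def using assms by (subst emeasure_distr) (auto simp: space_\<mu> vimage_def Int_def)

lemma emeasure_eq_measure_le:
  assumes A: "A \<in> sets borel"
  shows "ennreal c * emeasure eq_measure A \<le> emeasure node_measure A"
proof -
  have "A \<inter> {a..b} \<in> sets \<mu>"
    using A by (auto simp: sets_\<mu> sets_restrict_space)
  then have "emeasure \<mu> (A \<inter> {a..b}) \<le> (\<integral>\<^sup>+t\<in>A \<inter> {a..b}. ennreal (\<rho> t / c) \<partial>lborel)"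
    using admissible by (simp add: admissible_def)
  also have "\<dots> = (\<integral>\<^sup>+t. ennreal (1 / c) * (ennreal (indicat_real {a..b} t * \<rho> t) * indicator A t) \<partial>lborel)"
    using c \<rho>_bounds h_pos
    by (intro nn_integral_cong) (force simp: indicator_def ennreal_mult'[symmetric])
  also have "\<dots> = ennreal (1 / c) * emeasure node_measure A"
    using A by (subst nn_integral_cmult) (auto simp: emeasure_node_measure)
  finally have "ennreal c * emeasure eq_measure A \<le> ennreal c * (ennreal (1 / c) * emeasure node_measure A)"
    unfolding emeasure_eq_measure[OF A] by (intro mult_left_mono) auto
  also have "\<dots> = emeasure node_measure A"
    using c by (simp add: mult.assoc[symmetric] ennreal_mult'[symmetric])
  finally show ?thesis .
qed

sublocale eq: log_potential eq_measure a b "H / c"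
proof (rule log_potentialI)
  show "emeasure eq_measure {a..b} = 1" "emeasure eq_measure (- {a..b}) = 0"
    using admissible by (simp_all add: emeasure_eq_measure admissible_def)
  show "emeasure eq_measure A \<le> ennreal (H / c) * emeasure lborel A" if "A \<in> sets borel" for A
  proof -
    have "emeasure eq_measure A = ennreal (1 / c) * (ennreal c * emeasure eq_measure A)"
      using c by (simp add: mult.assoc[symmetric] ennreal_mult'[symmetric])
    also have "\<dots> \<le> ennreal (1 / c) * (ennreal H * emeasure lborel A)"
      using emeasure_eq_measure_le[OF that] emeasure_node_measure_le[OF that]
      by (intro mult_left_mono) (auto intro: order.trans)
    also have "\<dots> = ennreal (H / c) * emeasure lborel A"
      using c H_pos by (simp add: mult.assoc[symmetric] ennreal_mult'[symmetric])
    finally show ?thesis .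
  qed
qed (use c H_pos in \<open>auto simp: eq_measure_def\<close>)

lemma measure_eq_measure_le:
  assumes "A \<in> sets borel"
  shows "c * measure eq_measure A \<le> measure node_measure A"
  using emeasure_eq_measure_le[OF assms] c
  by (simp add: eq.emeasure_eq_measure node.emeasure_eq_measure ennreal_mult'[symmetric])

abbreviation var :: "real \<Rightarrow> real" where
  "var \<equiv> var_deriv a b \<rho> V c \<mu>"

text \<open>This is the combination that occurs in the exponents: the weight contributes the first
  two terms, and the squared Lagrange basis contributes twice the potential of
  \<open>k = c * N\<close> points.\<close>

lemma var_eq: "var z = Re (V (complex_of_real z)) + node.pot z - 2 * c * eq.pot z"
proof -
  have "eq.pot z = (LINT y|\<mu>. ln \<bar>z - y\<bar>)"
    unfolding eq.pot_def unfolding eq_measure_def by (subst integral_distr) auto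
  then show ?thesis by (simp add: var_deriv_def ext_field_def pot_eq)
qed

lemma continuous_on_var: "continuous_on {a..b} var"
  unfolding var_eq
  by (intro continuous_intros V_cont continuous_at_imp_continuous_on ballI node.isCont_pot eq.isCont_pot)

lemma \<psi>_cont: "continuous_on {a<..<b} \<psi>"
  using density by (simp add: continuous_density_def)

lemma \<psi>_measurable [measurable]: "(\<lambda>t. indicat_real {a<..<b} t * \<psi> t) \<in> borel_measurable borel"
  using borel_measurable_continuous_on_indicator[OF _ \<psi>_cont] by simp

lemma emeasure_eq_measure_density:
  assumes A: "A \<in> sets borel"
  shows "emeasure eq_measure A = (\<integral>\<^sup>+t. ennreal (indicat_real {a<..<b} t * \<psi> t) * indicator A t \<partial>lborel)"
proof -
  \<comment> \<open>Continuity of \<psi> is known only on the open interval. Restoring its arbitrary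
    values at the two endpoints gives measurability on \<open>{a..b}\<close>, without which the
    density could not be evaluated.\<close>
  have "(\<lambda>t. indicat_real {a<..<b} t * \<psi> t + (if t = a then \<psi> a else 0) + (if t = b then \<psi> b else 0))
      \<in> borel_measurable borel"
    by measurable
  moreover have "(\<lambda>t. \<psi> t * indicat_real {a..b} t)
      = (\<lambda>t. indicat_real {a<..<b} t * \<psi> t + (if t = a then \<psi> a else 0) + (if t = b then \<psi> b else 0))"
    using a_less_b by (auto simp: indicator_def fun_eq_iff)
  ultimately have "\<psi> \<in> borel_measurable (restrict_space lborel {a..b})"
    by (subst borel_measurable_restrict_space_iff) (auto simp: mult.commute)
  then have meas: "(\<lambda>t. ennreal (\<psi> t)) \<in> borel_measurable (restrict_space lborel {a..b})"
    by measurable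
  have "A \<inter> {a..b} \<in> sets (restrict_space lborel {a..b})"
    using A by (auto simp: sets_restrict_space)
  then have "emeasure \<mu> (A \<inter> {a..b})
      = (\<integral>\<^sup>+t. ennreal (\<psi> t) * indicator (A \<inter> {a..b}) t \<partial>restrict_space lborel {a..b})"
    using density meas by (simp add: continuous_density_def emeasure_density)
  also have "\<dots> = (\<integral>\<^sup>+t. ennreal (\<psi> t) * indicator (A \<inter> {a..b}) t * indicator {a..b} t \<partial>lborel)"
    by (subst nn_integral_restrict_space) auto
  also have "\<dots> = (\<integral>\<^sup>+t. ennreal (indicat_real {a<..<b} t * \<psi> t) * indicator A t \<partial>lborel)"
    using AE_lborel_singleton[of a] AE_lborel_singleton[of b]
    by (intro nn_integral_cong_AE, eventually_elim) (auto simp: indicator_def)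
  finally show ?thesis using A by (simp add: emeasure_eq_measure)
qed

lemma open_interval_around:
  fixes f g :: "real \<Rightarrow> real"
  assumes "continuous_on {a<..<b} f" "continuous_on {a<..<b} g"
    and "z \<in> {u<..<v}" "{u<..<v} \<subseteq> {a<..<b}" "f z < g z"
  obtains e where "0 < e" "{z - e..z + e} \<subseteq> {u<..<v}" "\<And>t. t \<in> {z - e..z + e} \<Longrightarrow> f t < g t"
proof -
  obtain A where A: "open A" "A \<inter> {a<..<b} = {t \<in> {a<..<b}. f t < g t}"
    using open_Collect_less_Int[OF assms(1,2)] by blast
  have "z \<in> A \<inter> {a<..<b}" using A(2) assms(3,4,5) by blast
  then have "open (A \<inter> {u<..<v})" "z \<in> A \<inter> {u<..<v}"
    using A(1) assms(3) by auto
  then obtain e where "0 < e" "cball z e \<subseteq> A \<inter> {u<..<v}"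
    using open_contains_cball by meson
  then have e: "0 < e" "{z - e..z + e} \<subseteq> {u<..<v}" "{z - e..z + e} \<subseteq> A \<inter> {a<..<b}"
    using assms(4) by (auto simp only: cball_eq_atLeastAtMost)
  show ?thesis
    by (rule that[OF e(1,2)]) (use e(3) A(2) in blast)
qed

text \<open>The constraint concerns measures of sets. If it failed pointwise, continuity would give
  an excess of at least \<open>d\<close> on a whole interval, and integrating over that interval
  would contradict the constraint.\<close>

lemma \<psi>_le:
  assumes z: "z \<in> {a<..<b}"
  shows "\<psi> z \<le> \<rho> z / c"
proof (rule ccontr)
  assume "\<not> \<psi> z \<le> \<rho> z / c"
  \<comment> \<open>Half of the excess, so that the inequality with margin \<open>d\<close> is
    strict at \<open>z\<close> and persists nearby.\<close>
  define d where "d = (\<psi> z - \<rho> z / c) / 2"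
  have d: "0 < d" "\<rho> z / c + d < \<psi> z"
    using \<open>\<not> \<psi> z \<le> \<rho> z / c\<close> by (auto simp: d_def field_simps)
  have cont: "continuous_on {a<..<b} (\<lambda>t. \<rho> t / c + d)"
    using c by (intro continuous_intros continuous_on_subset[OF \<rho>_cont]) auto
  obtain e where e: "0 < e" "{z - e..z + e} \<subseteq> {a<..<b}"
      "\<And>t. t \<in> {z - e..z + e} \<Longrightarrow> \<rho> t / c + d < \<psi> t"
    using open_interval_around[OF cont \<psi>_cont z order.refl d(2)] by blast
  let ?I = "{z - e..z + e}"
  have \<rho>_on: "0 \<le> \<rho> t" if "t \<in> ?I" for t
    using that e(2) \<rho>_bounds[of t] h_pos by force
  have "emeasure node_measure ?I + ennreal (c * d * (2 * e))
      = (\<integral>\<^sup>+t. ennreal (indicat_real {a..b} t * \<rho> t) * indicator ?I t \<partial>lborel) + (\<integral>\<^sup>+t. ennreal (c * d) * indicator ?I t \<partial>lborel)"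
    using e(1) c d(1) by (simp add: emeasure_node_measure nn_integral_cmult_indicator ennreal_mult')
  also have "\<dots> = (\<integral>\<^sup>+t. ennreal (indicat_real {a..b} t * \<rho> t) * indicator ?I t + ennreal (c * d) * indicator ?I t \<partial>lborel)"
    by (subst nn_integral_add) auto
  also have "\<dots> \<le> (\<integral>\<^sup>+t. ennreal c * (ennreal (indicat_real {a<..<b} t * \<psi> t) * indicator ?I t) \<partial>lborel)"
  proof (rule nn_integral_mono)
    fix t
    show "ennreal (indicat_real {a..b} t * \<rho> t) * indicator ?I t + ennreal (c * d) * indicator ?I t
      \<le> ennreal c * (ennreal (indicat_real {a<..<b} t * \<psi> t) * indicator ?I t)"
    proof (cases "t \<in> ?I")
      case True
      then have "\<rho> t + c * d \<le> c * \<psi> t"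
        using e(3)[of t] c by (simp add: field_simps)
      moreover have "t \<in> {a<..<b}" "t \<in> {a..b}" using True e(2) by force+
      ultimately show ?thesis
        using True \<rho>_on[OF True] c d(1)
        by (simp add: ennreal_plus[symmetric] ennreal_mult'[symmetric] del: ennreal_plus) (rule ennreal_leI)
    qed simp
  qed
  also have "\<dots> = ennreal c * emeasure eq_measure ?I"
    by (subst nn_integral_cmult) (auto simp: emeasure_eq_measure_density)
  also have "\<dots> \<le> emeasure node_measure ?I"
    by (rule emeasure_eq_measure_le) simp
  finally have "emeasure node_measure ?I + ennreal (c * d * (2 * e)) \<le> emeasure node_measure ?I" .
  moreover have "0 < c * d * (2 * e)" using c d(1) e(1) by simp
  ultimately show False
    by (simp add: node.emeasure_eq_measure ennreal_plus[symmetric] del: ennreal_plus)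
qed

text \<open>Near a point where \<open>\<psi>\<close> is positive, either \<open>0 < \<psi> < \<rho> / c\<close> somewhere, which gives a band, or
  \<open>\<psi> = \<rho> / c\<close> throughout, which gives a saturated region.\<close>

lemma var_le_near_support:
  assumes uv: "{u<..<v} \<subseteq> {a<..<b}" and pos: "0 < measure eq_measure {u<..<v}"
  obtains z where "z \<in> {u<..<v}" "var z \<le> ell"
proof -
  have "\<exists>z\<in>{u<..<v}. 0 < \<psi> z"
  proof (rule ccontr)
    assume none: "\<not> (\<exists>z\<in>{u<..<v}. 0 < \<psi> z)"
    have "emeasure eq_measure {u<..<v} = (\<integral>\<^sup>+(t::real). 0 \<partial>lborel)"
      unfolding emeasure_eq_measure_density[OF borel_open[OF open_greaterThanLessThan]]
    proof (intro nn_integral_cong)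
      fix t
      have "\<psi> t \<le> 0" if "t \<in> {u<..<v}" using none that by (simp add: not_less)
      then show "ennreal (indicat_real {a<..<b} t * \<psi> t) * indicator {u<..<v} t = 0"
        by (cases "t \<in> {u<..<v}") (simp_all add: ennreal_neg mult_nonneg_nonpos)
    qed
    then show False using pos by (simp add: measure_def)
  qed
  then obtain z where z: "z \<in> {u<..<v}" "0 < \<psi> z" by blast
  have cont: "continuous_on {a<..<b} (\<lambda>t. \<rho> t / c)"
    using c by (intro continuous_intros continuous_on_subset[OF \<rho>_cont]) auto
  have subinterval: "open_subinterval a b {t - e<..<t + e}" "t \<in> {t - e<..<t + e}"
    if "0 < e" "{t - e..t + e} \<subseteq> {u<..<v}" for t e
  proof -
    have "{t - e..t + e} \<subseteq> {a<..<b}" using that(2) uv by blast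
    moreover have "t - e \<in> {t - e..t + e}" "t + e \<in> {t - e..t + e}" using that(1) by auto
    ultimately have "t - e \<in> {a<..<b}" "t + e \<in> {a<..<b}" by blast+
    then show "open_subinterval a b {t - e<..<t + e}"
      using that(1) unfolding open_subinterval_def
      by (intro exI[of _ "t - e"] exI[of _ "t + e"]) simp
    show "t \<in> {t - e<..<t + e}" using that(1) by simp
  qed
  show ?thesis
  proof (cases "\<exists>t\<in>{u<..<v}. 0 < \<psi> t \<and> \<psi> t < \<rho> t / c")
    case True
    then obtain t where t: "t \<in> {u<..<v}" "0 < \<psi> t" "\<psi> t < \<rho> t / c" by blast
    obtain e1 where e1: "0 < e1" "{t - e1..t + e1} \<subseteq> {u<..<v}" "\<And>y. y \<in> {t - e1..t + e1} \<Longrightarrow> \<psi> y < \<rho> y / c"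
      using open_interval_around[OF \<psi>_cont cont t(1) uv t(3)] by blast
    obtain e2 where e2: "0 < e2" "{t - e2..t + e2} \<subseteq> {u<..<v}" "\<And>y. y \<in> {t - e2..t + e2} \<Longrightarrow> 0 < \<psi> y"
      using open_interval_around[OF continuous_on_const \<psi>_cont t(1) uv t(2)] by blast
    define e where "e = min e1 e2"
    have sub: "{t - e..t + e} \<subseteq> {t - e1..t + e1}" "{t - e..t + e} \<subseteq> {t - e2..t + e2}"
        "{t - e<..<t + e} \<subseteq> {t - e..t + e}"
      by (auto simp: e_def)
    have e: "0 < e" "{t - e..t + e} \<subseteq> {u<..<v}"
      using e1(1) e2(1) order.trans[OF sub(1) e1(2)] by (simp_all add: e_def)
    have e3: "\<forall>y\<in>{t - e<..<t + e}. 0 < \<psi> y \<and> \<psi> y < \<rho> y / c"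
      using e1(3) e2(3) sub by blast
    obtain I where "maximal_subinterval a b (\<lambda>I. \<forall>y\<in>I. 0 < \<psi> y \<and> \<psi> y < \<rho> y / c) I" "t \<in> I"
      using maximal_subinterval_exists[OF subinterval[OF e(1,2)] e3] by blast
    then have "var t = ell"
      using variational by (auto simp: strict_variational_conditions_def band_interval_def)
    then show ?thesis using that[of t] t by simp
  next
    case False
    obtain e where e: "0 < e" "{z - e..z + e} \<subseteq> {u<..<v}" "\<And>y. y \<in> {z - e..z + e} \<Longrightarrow> 0 < \<psi> y"
      using open_interval_around[OF continuous_on_const \<psi>_cont z(1) uv z(2)] by blast
    have "\<forall>y\<in>{z - e<..<z + e}. \<psi> y = \<rho> y / c"
    proof
      fix y assume y: "y \<in> {z - e<..<z + e}"
      then have "y \<in> {z - e..z + e}" by simp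
      then have "y \<in> {u<..<v}" "0 < \<psi> y" using e by blast+
      moreover have "\<psi> y \<le> \<rho> y / c" using \<open>y \<in> {u<..<v}\<close> uv by (intro \<psi>_le) blast
      ultimately show "\<psi> y = \<rho> y / c" using False by force
    qed
    then obtain I where "maximal_subinterval a b (\<lambda>I. \<forall>y\<in>I. \<psi> y = \<rho> y / c) I" "z \<in> I"
      using maximal_subinterval_exists[OF subinterval[OF e(1,2)]] by blast
    then have "var z < ell"
      using variational by (auto simp: strict_variational_conditions_def saturated_interval_def)
    then show ?thesis using that[of z] z by simp
  qed
qed

end

section \<open>Kernel bounds in a void\<close>

lemma weight_eq_exp:
  "weight x VN N t = exp (- real N * Re (VN N (complex_of_real t)) - (\<Sum>s\<in>nodes x N - {t}. ln \<bar>t - s\<bar>))"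
proof -
  have "(\<Prod>s\<in>nodes x N - {t}. inverse \<bar>t - s\<bar>) = (\<Prod>s\<in>nodes x N - {t}. exp (- ln \<bar>t - s\<bar>))"
    by (intro prod.cong) (auto simp: exp_minus)
  also have "\<dots> = exp (- (\<Sum>s\<in>nodes x N - {t}. ln \<bar>t - s\<bar>))"
    by (simp add: exp_sum nodes_def sum_negf[symmetric])
  finally show ?thesis
    by (simp add: weight_def exp_diff exp_minus divide_inverse)
qed

lemma weight_pos: "0 < weight x VN N t"
  by (simp add: weight_eq_exp)

lemma repr_kernel_diagonal:
  "repr_kernel x VN p N k t t = weight x VN N t * (\<Sum>n<k. poly (p N n) t * poly (p N n) t)"
  using weight_pos[of x VN N t] by (simp add: repr_kernel_def)

lemma repr_kernel_le_diagonal: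
  assumes "repr_kernel x VN p N k s s \<le> U" "repr_kernel x VN p N k t t \<le> U"
  shows "\<bar>repr_kernel x VN p N k s t\<bar> \<le> U"
proof -
  let ?w = "weight x VN N"
  let ?S = "\<lambda>s t. \<Sum>n<k. poly (p N n) s * poly (p N n) t"
  have S_nonneg: "0 \<le> ?S r r" for r by (intro sum_nonneg) simp
  have K_nonneg: "0 \<le> repr_kernel x VN p N k r r" for r
    using weight_pos[of x VN N r] S_nonneg[of r] by (simp add: repr_kernel_diagonal)
  have "(repr_kernel x VN p N k s t)\<^sup>2 = ?w s * ?w t * (?S s t)\<^sup>2"
    using weight_pos[of x VN N] by (simp add: repr_kernel_def power_mult_distrib less_imp_le)
  also have "\<dots> \<le> ?w s * ?w t * (?S s s * ?S t t)"
    using Cauchy_Schwarz_ineq_sum[of "\<lambda>n. poly (p N n) s" "\<lambda>n. poly (p N n) t" "{..<k}"] weight_pos[of x VN N]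
    by (intro mult_left_mono) (auto simp: power2_eq_square less_imp_le)
  also have "\<dots> = repr_kernel x VN p N k s s * repr_kernel x VN p N k t t"
    by (simp add: repr_kernel_diagonal)
  also have "\<dots> \<le> U\<^sup>2"
    unfolding power2_eq_square using assms K_nonneg by (intro mult_mono) (auto intro: order.trans)
  finally show ?thesis
    using assms(1) K_nonneg[of s] by (metis abs_le_square_iff abs_of_nonneg order.trans)
qed

context equilibrium_setting
begin

text \<open>Discretizing the node measure with \<kappa> equal to \<open>N\<close> must select every
  node, so \<open>discretization\<close> also supplies the discrepancy bounds for the full set of
  nodes.\<close>

lemma node_log_sum_approx:
  assumes "0 < N" and t: "t \<in> nodes x N" and size: "1 / (H * real N) \<le> b - a"
  shows "\<bar>(\<Sum>y\<in>nodes x N - {t}. ln \<bar>t - y\<bar>) - real N * node.pot t\<bar>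
    \<le> 2 * (ln (b - a) + ln (H * real N)) + \<bar>ln (H * real N)\<bar> + 2"
proof -
  let ?\<epsilon> = "1 / (H * real N)"
  have \<epsilon>: "0 < ?\<epsilon>" "ln ?\<epsilon> = - ln (H * real N)"
    using H_pos \<open>0 < N\<close> by (simp_all add: ln_div)
  obtain Y where Y: "Y \<subseteq> nodes x N" "card Y = N"
    "\<forall>z. \<bar>real (card (Y \<inter> {..z})) - real N * measure node_measure {..z}\<bar> \<le> 1"
    "\<forall>z. \<bar>real (card (Y \<inter> {..<z})) - real N * measure node_measure {..z}\<bar> \<le> 1"
    by (rule discretization[OF node.log_potential_axioms \<open>0 < N\<close> order.refl])
  have fin: "finite (nodes x N)" by (simp add: nodes_def)
  have X: "Y = nodes x N"
    using Y(1,2) card_nodes fin by (intro card_subset_eq) auto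
  have X_in: "nodes x N \<subseteq> {a..b}"
    using node_in by (force simp: nodes_def)
  have gap: "?\<epsilon> \<le> \<bar>t - y\<bar>" if "y \<in> nodes x N - {t}" for y
    using that t node_gap unfolding nodes_def by blast
  have "\<bar>(\<Sum>y\<in>nodes x N - {t}. ln \<bar>t - y\<bar>) - real N * node.pot t\<bar>
    \<le> 2 * (ln (b - a) - ln ?\<epsilon>) + \<bar>ln ?\<epsilon>\<bar> + 2 * real N * H * ?\<epsilon>"
    using Y(3,4) t X_in
    by (intro node.log_sum_approx[OF fin X_in _ _ _ _ gap \<epsilon>(1) size order.refl])
      (auto simp only: X card_nodes)
  then show ?thesis using \<epsilon>(2) H_pos \<open>0 < N\<close> by simp
qed

text \<open>The constants in the exponent: the weights at \<open>s\<close> and \<open>t\<close>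
  contribute \<open>2 * C + 2 * E\<close>, the squared Lagrange basis contributes
  \<open>4 * E\<close>, and the gap \<delta> minus the oscillation \<open>\<delta> / 4\<close>
  leaves \<open>3 / 4\<close>. The common shift \<open>g\<close> cancels in the quotient of the two
  weights. The factor \<open>real N\<close> bounds the number of summands.\<close>

lemma kernel_diagonal_le:
  fixes N k :: nat and E d \<delta> C g :: real
  defines "E \<equiv> 2 * (ln (b - a) + ln (H * real N)) + \<bar>ln (H * real N)\<bar> + 2"
  assumes N: "0 < N" "real k = c * real N" "1 / (H * real N) \<le> b - a"
    and orth: "orthonormal_polys x VN p"
    and VN: "\<And>t. t \<in> {a..b} \<Longrightarrow>
      \<bar>real N * Re (VN N (complex_of_real t)) - real N * Re (V (complex_of_real t)) - g\<bar> \<le> C"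
    and s: "s \<in> nodes x N" "measure eq_measure {s - d<..<s + d} = 0" "ell + \<delta> \<le> var s"
    and d: "0 < d" "1 / (h * real N) \<le> d / 2"
    and osc: "\<And>t z. t \<in> {a..b} \<Longrightarrow> z \<in> {a..b} \<Longrightarrow> \<bar>t - z\<bar> \<le> 1 / (h * real N) \<Longrightarrow> \<bar>var t - var z\<bar> \<le> \<delta> / 4"
  shows "repr_kernel x VN p N k s s \<le> real N * exp (- (3 / 4) * \<delta> * real N + 2 * C + 6 * E - 2 * ln (d / 2))"
proof -
  let ?\<epsilon> = "1 / (H * real N)"
  let ?X = "nodes x N"
  let ?w = "weight x VN N"
  define B where "B = exp (- (3 / 4) * \<delta> * real N + 2 * C + 6 * E - 2 * ln (d / 2))"
  have "real k * measure eq_measure A \<le> real N * measure node_measure A" if "A \<in> sets borel" for A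
    using measure_eq_measure_le[OF that] N by (simp add: mult_ac)
  from discretization[OF eq.log_potential_axioms \<open>0 < N\<close> this]
  obtain Y where Y: "Y \<subseteq> ?X" "card Y = k"
    "\<forall>z. \<bar>real (card (Y \<inter> {..z})) - real k * measure eq_measure {..z}\<bar> \<le> 1"
    "\<forall>z. \<bar>real (card (Y \<inter> {..<z})) - real k * measure eq_measure {..z}\<bar> \<le> 1"
    "\<forall>j<N. x N j \<in> Y \<longrightarrow> 0 < measure eq_measure {(if j = 0 then a else x N (j - 1))<..<x N j}"
    by blast
  have finX: "finite ?X" by (simp add: nodes_def)
  have finY: "finite Y" using Y(1) finX by (rule finite_subset)
  have X_in: "t \<in> {a<..<b}" if "t \<in> ?X" for t
    using that node_in by (auto simp: nodes_def)
  have "k < N"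
  proof -
    have "real k < real N" using N c by simp
    then show ?thesis by simp
  qed
  have \<epsilon>: "0 < ?\<epsilon>" "ln ?\<epsilon> = - ln (H * real N)"
    using H_pos N by (simp_all add: ln_div)
  have gap: "?\<epsilon> \<le> \<bar>t - y\<bar>" if "t \<in> ?X" "y \<in> ?X" "t \<noteq> y" for t y
    using that node_gap unfolding nodes_def by blast
  have eq_approx: "\<bar>(\<Sum>y\<in>Y - {t}. ln \<bar>t - y\<bar>) - real k * eq.pot t\<bar> \<le> E" if "t \<in> ?X" for t
  proof -
    have Y_in: "Y \<subseteq> {a..b}" using Y(1) X_in by force
    have gap': "?\<epsilon> \<le> \<bar>t - y\<bar>" if "y \<in> Y - {t}" for y
      using gap[OF \<open>t \<in> ?X\<close>, of y] that Y(1) by blast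
    have "\<bar>(\<Sum>y\<in>Y - {t}. ln \<bar>t - y\<bar>) - real k * eq.pot t\<bar>
      \<le> 2 * (ln (b - a) - ln ?\<epsilon>) + \<bar>ln ?\<epsilon>\<bar> + 2 * real k * (H / c) * ?\<epsilon>"
      using Y(2,3,4) X_in[OF that]
      by (intro eq.log_sum_approx[OF finY Y_in _ _ _ _ gap' \<epsilon>(1) N(3) order.refl])
        (auto simp only: greaterThanLessThan_iff atLeastAtMost_iff less_imp_le)
    \<comment> \<open>Since \<open>k = c * N\<close>, the larger density bound \<open>H / c\<close>
      is compensated by the smaller number of points, and the same \<open>E\<close> serves for both
      measures.\<close>
    also have "2 * real k * (H / c) * ?\<epsilon> = 2"
      using N c H_pos by simp
    finally show ?thesis using \<epsilon>(2) by (simp add: E_def)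
  qed
  have node_approx: "\<bar>(\<Sum>y\<in>?X - {t}. ln \<bar>t - y\<bar>) - real N * node.pot t\<bar> \<le> E" if "t \<in> ?X" for t
    unfolding E_def using that N by (intro node_log_sum_approx)
  \<comment> \<open>Immediately to the left of \<open>t\<close>, within
    \<open>1 / (h * real N)\<close>, there is mass of the equilibrium measure. It provides a point
    with \<open>var \<le> ell\<close>, from which \<open>osc\<close> leads to \<open>t\<close>. If
    \<open>t\<close> were closer than \<open>d / 2\<close> to \<open>s\<close>, this mass would lie
    inside the null interval around \<open>s\<close>.\<close>
  have Y_var: "var t \<le> ell + \<delta> / 4" and Y_far: "d / 2 \<le> \<bar>s - t\<bar>" if tY: "t \<in> Y" for t
  proof -
    obtain j where j: "j < N" "t = x N j" using subsetD[OF Y(1) tY] by (auto simp: nodes_def)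
    define u where "u = (if j = 0 then a else x N (j - 1))"
    have pos: "0 < measure eq_measure {u<..<t}"
      using Y(5) j tY by (simp add: u_def)
    have u: "a \<le> u" "t < b" "t - u \<le> 1 / (h * real N)"
      using node_in[of "j - 1" N] node_in[of j N] node_close[of j N] j by (auto simp: u_def less_imp_le)
    then have "{u<..<t} \<subseteq> {a<..<b}" by auto
    then obtain z where z: "z \<in> {u<..<t}" "var z \<le> ell"
      using var_le_near_support[OF _ pos] by blast
    have "\<bar>var t - var z\<bar> \<le> \<delta> / 4"
      using z u by (intro osc) auto
    then show "var t \<le> ell + \<delta> / 4" using z by linarith
    show "d / 2 \<le> \<bar>s - t\<bar>"
    proof (rule ccontr)
      assume "\<not> d / 2 \<le> \<bar>s - t\<bar>"
      then have "s - d < u" "t < s + d" using u(3) d by linarith+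
      then have "{u<..<t} \<subseteq> {s - d<..<s + d}" by auto
      then have "measure eq_measure {u<..<t} \<le> measure eq_measure {s - d<..<s + d}"
        by (intro eq.finite_measure_mono) auto
      then show False using pos s(2) by simp
    qed
  qed
  have "s \<notin> Y" using Y_far d by force
  have term_le: "?w s * ((\<Prod>y\<in>Y - {t}. (s - y) / (t - y))\<^sup>2 / ?w t) \<le> B" if "t \<in> Y" for t
  proof -
    define S where "S r = (\<Sum>y\<in>Y - {t}. ln \<bar>r - y\<bar>)" for r
    have "t \<in> ?X" using that Y(1) by blast
    have "\<bar>(s - y) / (t - y)\<bar> = exp (ln \<bar>s - y\<bar> - ln \<bar>t - y\<bar>)" if "y \<in> Y - {t}" for y
      using that \<open>s \<notin> Y\<close> by (cases "s = y") (auto simp: exp_diff)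
    then have "\<bar>\<Prod>y\<in>Y - {t}. (s - y) / (t - y)\<bar> = (\<Prod>y\<in>Y - {t}. exp (ln \<bar>s - y\<bar> - ln \<bar>t - y\<bar>))"
      unfolding abs_prod by (intro prod.cong refl)
    also have "\<dots> = exp (S s - S t)"
      using finY by (simp add: exp_sum[symmetric] sum_subtractf S_def)
    finally have "(\<Prod>y\<in>Y - {t}. (s - y) / (t - y))\<^sup>2 = exp (2 * (S s - S t))"
      by (metis exp_double power2_abs)
    then have "?w s * ((\<Prod>y\<in>Y - {t}. (s - y) / (t - y))\<^sup>2 / ?w t)
      = exp ((- real N * Re (VN N (complex_of_real s)) - (\<Sum>y\<in>?X - {s}. ln \<bar>s - y\<bar>)) + 2 * (S s - S t)
          - (- real N * Re (VN N (complex_of_real t)) - (\<Sum>y\<in>?X - {t}. ln \<bar>t - y\<bar>)))"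
      by (simp only: weight_eq_exp exp_add exp_diff) simp
    also have "\<dots> \<le> B"
      unfolding B_def exp_le_cancel_iff
    proof -
      \<comment> \<open>The product for \<open>t\<close> omits the factor \<open>s - t\<close>,
        while \<open>eq_approx\<close> at \<open>s\<close> sums over all of \<open>Y\<close>. The
        difference is the source of \<open>ln (d / 2)\<close>.\<close>
      have S_s: "S s = (\<Sum>y\<in>Y - {s}. ln \<bar>s - y\<bar>) - ln \<bar>s - t\<bar>"
        using \<open>s \<notin> Y\<close> finY that by (simp add: S_def sum_diff1)
      have "ln (d / 2) \<le> ln \<bar>s - t\<bar>"
        using Y_far[OF that] d(1) by (subst ln_le_cancel_iff) linarith+
      moreover have "real N * var t \<le> real N * (ell + \<delta> / 4)" "real N * (ell + \<delta>) \<le> real N * var s"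
        using Y_var[OF that] s(3) by (auto intro!: mult_left_mono)
      moreover have "real N * var r = real N * Re (V (complex_of_real r)) + real N * node.pot r - 2 * (real k * eq.pot r)" for r
        unfolding var_eq N(2) by (simp add: algebra_simps)
      moreover have "\<bar>S t - real k * eq.pot t\<bar> \<le> E"
        using eq_approx[OF \<open>t \<in> ?X\<close>] by (simp add: S_def)
      moreover have "s \<in> {a..b}" "t \<in> {a..b}"
        using X_in[OF s(1)] X_in[OF \<open>t \<in> ?X\<close>] by auto
      ultimately show "(- real N * Re (VN N (complex_of_real s)) - (\<Sum>y\<in>?X - {s}. ln \<bar>s - y\<bar>)) + 2 * (S s - S t)
          - (- real N * Re (VN N (complex_of_real t)) - (\<Sum>y\<in>?X - {t}. ln \<bar>t - y\<bar>))
        \<le> - (3 / 4) * \<delta> * real N + 2 * C + 6 * E - 2 * ln (d / 2)"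
        using node_approx[OF s(1)] node_approx[OF \<open>t \<in> ?X\<close>] eq_approx[OF s(1)] VN[of s] VN[of t] S_s
        by (simp add: algebra_simps abs_le_iff)
    qed
    finally show ?thesis .
  qed
  have "(\<Sum>n<k. poly (p N n) s * poly (p N n) s) \<le> (\<Sum>t\<in>Y. (\<Prod>y\<in>Y - {t}. (s - y) / (t - y))\<^sup>2 / ?w t)"
    using orth \<open>k < N\<close> finX Y(1,2) weight_pos[of x VN N]
    by (intro christoffel_le_lagrange[of ?X]) (auto simp: orthonormal_polys_def)
  then have "repr_kernel x VN p N k s s \<le> ?w s * (\<Sum>t\<in>Y. (\<Prod>y\<in>Y - {t}. (s - y) / (t - y))\<^sup>2 / ?w t)"
    unfolding repr_kernel_diagonal using weight_pos[of x VN N s] by (intro mult_left_mono) auto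
  also have "\<dots> = (\<Sum>t\<in>Y. ?w s * ((\<Prod>y\<in>Y - {t}. (s - y) / (t - y))\<^sup>2 / ?w t))"
    by (rule sum_distrib_left)
  also have "\<dots> \<le> real (card Y) * B"
    using term_le by (rule sum_bounded_above)
  also have "\<dots> \<le> real N * B"
    using Y(2) \<open>k < N\<close> by (intro mult_right_mono) (auto simp: B_def)
  finally show ?thesis by (simp add: B_def)
qed

end

section \<open>Uniformity in \<open>N\<close> and the final estimate\<close>

lemma real_analytic_near_continuous:
  assumes "real_analytic_near f S"
  shows "continuous_on S f"
proof -
  obtain U g where g: "complex_of_real ` S \<subseteq> U" "g holomorphic_on U"
      "\<And>t. t \<in> S \<Longrightarrow> g (complex_of_real t) = complex_of_real (f t)"
    using assms by (auto simp: real_analytic_near_def)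
  have "continuous_on S (\<lambda>t. Re (g (complex_of_real t)))"
    using g(1) by (intro continuous_intros continuous_on_compose2[OF holomorphic_on_imp_continuous_on[OF g(2)]]) auto
  then show ?thesis
    by (rule continuous_on_eq) (simp add: g(3))
qed

text \<open>After multiplication by \<open>N\<close>, the expansion leaves the constant \<gamma> and
  a remainder \<eta> divided by \<open>N\<close>, which the finite limsup bounds uniformly on
  \<open>G\<close>. The constant \<gamma> becomes the shift \<open>g\<close> of
  \<open>kernel_diagonal_le\<close>.\<close>

lemma weight_potentials_bound:
  assumes "weight_potentials a b G V VN \<gamma> \<eta>"
  obtains C where "\<forall>\<^sub>F N in sequentially. \<forall>t\<in>{a..b}.
    \<bar>real N * Re (VN N (complex_of_real t)) - real N * Re (V (complex_of_real t)) - \<gamma>\<bar> \<le> C"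
proof -
  from assms have sub: "complex_of_real ` {a..b} \<subseteq> G"
    and VN: "\<forall>\<^sub>F N in sequentially. \<forall>z\<in>G. VN N z = V z + complex_of_real \<gamma> / of_nat N + \<eta> N z / (of_nat N)^2"
    and lim: "limsup (\<lambda>N. SUP z\<in>G. ereal (cmod (\<eta> N z))) < \<infinity>"
    by (auto simp: weight_potentials_def elim: eventually_mono)
  obtain C :: nat where "limsup (\<lambda>N. SUP z\<in>G. ereal (cmod (\<eta> N z))) < ereal (real C)"
    using less_PInf_Ex_of_nat lim by auto
  then have "\<forall>\<^sub>F N in sequentially. (SUP z\<in>G. ereal (cmod (\<eta> N z))) < ereal (real C)"
    by (rule Limsup_lessD)
  with VN eventually_gt_at_top[of 0]
  have "\<forall>\<^sub>F N in sequentially. \<forall>t\<in>{a..b}.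
    \<bar>real N * Re (VN N (complex_of_real t)) - real N * Re (V (complex_of_real t)) - \<gamma>\<bar> \<le> real C"
  proof eventually_elim
    case (elim N)
    show ?case
    proof
      fix t assume "t \<in> {a..b}"
      then have t: "complex_of_real t \<in> G" using sub by blast
      have "Re (VN N (complex_of_real t))
        = Re (V (complex_of_real t)) + \<gamma> / real N + Re (\<eta> N (complex_of_real t)) / (real N)\<^sup>2"
      proof -
        have "complex_of_real \<gamma> / of_nat N = complex_of_real (\<gamma> / real N)"
          "(of_nat N :: complex)\<^sup>2 = complex_of_real ((real N)\<^sup>2)"
          by simp_all
        then have "VN N (complex_of_real t) = V (complex_of_real t) + complex_of_real (\<gamma> / real N)
            + \<eta> N (complex_of_real t) / complex_of_real ((real N)\<^sup>2)"
          using elim(1) t by (simp only:)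
        then show ?thesis by (simp only: plus_complex.sel Re_complex_of_real Re_divide_of_real)
      qed
      then have Re_eq: "real N * Re (VN N (complex_of_real t)) - real N * Re (V (complex_of_real t)) - \<gamma>
        = Re (\<eta> N (complex_of_real t)) / real N"
        using elim(2) by (simp add: field_simps power2_eq_square)
      have "ereal (cmod (\<eta> N (complex_of_real t))) < ereal (real C)"
        using elim(3) t by (meson SUP_upper le_less_trans)
      then have "\<bar>Re (\<eta> N (complex_of_real t))\<bar> \<le> real C * 1"
        using abs_Re_le_cmod[of "\<eta> N (complex_of_real t)"] by simp
      also have "\<dots> \<le> real C * real N"
        using elim(2) by (intro mult_left_mono) auto
      finally have "\<bar>Re (\<eta> N (complex_of_real t))\<bar> \<le> real C * real N" .
      with Re_eq show "\<bar>real N * Re (VN N (complex_of_real t)) - real N * Re (V (complex_of_real t)) - \<gamma>\<bar> \<le> real C"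
        using elim(2) by (simp add: abs_divide divide_le_eq)
    qed
  qed
  then show ?thesis by (rule that)
qed

lemma eventually_log_error_absorbed:
  fixes \<delta> H Q R :: real
  assumes "0 < \<delta>" "0 < H"
  shows "\<forall>\<^sub>F N in sequentially.
    real N * exp (- (3 / 4) * \<delta> * real N + Q
      + 6 * (2 * (R + ln (H * real N)) + \<bar>ln (H * real N)\<bar> + 2)) \<le> exp (- (\<delta> / 2) * real N)"
proof -
  \<comment> \<open>The coefficient 19 is 12 + 6 from the two kinds of
    \<open>ln (H * real N)\<close> and 1 from the prefactor \<open>real N\<close>; 18 is 12 + 6 for
    \<open>ln H\<close>. The right-hand side is the part of the exponent given up between
    \<open>3 / 4\<close> and \<open>1 / 2\<close>.\<close>
  have "\<forall>\<^sub>F N in sequentially. Q + 12 * R + 12 + 19 * ln (real N) + 18 * \<bar>ln H\<bar> \<le> \<delta> / 4 * real N"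
    using assms(1) by real_asymp
  then show ?thesis
    using eventually_gt_at_top[of 0]
  proof eventually_elim
    case (elim N)
    have ln: "ln (H * real N) = ln H + ln (real N)" "0 \<le> ln (real N)"
      using elim(2) assms(2) by (simp_all add: ln_mult)
    have "real N * exp (- (3 / 4) * \<delta> * real N + Q
        + 6 * (2 * (R + ln (H * real N)) + \<bar>ln (H * real N)\<bar> + 2))
      = exp (ln (real N) + (- (3 / 4) * \<delta> * real N + Q
        + 6 * (2 * (R + ln (H * real N)) + \<bar>ln (H * real N)\<bar> + 2)))"
      using elim(2) by (simp add: exp_add)
    also have "\<dots> \<le> exp (- (\<delta> / 2) * real N)"
      unfolding exp_le_cancel_iff ln(1) using elim(1) ln(2) by (simp add: abs_if split: if_splits)
    finally show ?case .
  qed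
qed

theorem theorem6:
  fixes a b c \<gamma> ell :: real
    and \<rho> \<psi> :: "real \<Rightarrow> real"
    and x :: "nat \<Rightarrow> nat \<Rightarrow> real"
    and G :: "complex set"
    and V :: "complex \<Rightarrow> complex"
    and VN \<eta> :: "nat \<Rightarrow> complex \<Rightarrow> complex"
    and p :: "nat \<Rightarrow> nat \<Rightarrow> real poly"
    and \<mu> :: "real measure"
    and \<Gamma> :: "real set"
  assumes "a < b"
    and "node_density a b \<rho>"
    and "node_system a b \<rho> x"
    and "weight_potentials a b G V VN \<gamma> \<eta>"
    and "orthonormal_polys x VN p"
    and "c \<in> \<rat>" and "0 < c" and "c < 1"
    and "equilibrium_measure a b \<rho> V c \<mu>"
    and "continuous_density a b \<mu> \<psi>"
    and "regular_density a b \<rho> c \<psi>"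
    and "strict_variational_conditions a b \<rho> V c \<mu> \<psi> ell"
    and "void_interval a b \<mu> \<Gamma>"
  shows "\<forall>F. compact F \<and> F \<subseteq> \<Gamma> \<longrightarrow>
    (\<exists>K\<^sub>F>0. \<exists>M. \<forall>\<^sub>F N in sequentially. \<forall>k. real k = c * real N \<longrightarrow>
       (\<forall>s \<in> nodes x N \<inter> F. \<bar>repr_kernel x VN p N k s s\<bar> \<le> M * exp (- K\<^sub>F * real N)) \<and>
       (\<forall>s \<in> nodes x N \<inter> F. \<forall>t \<in> nodes x N \<inter> F. s \<noteq> t \<longrightarrow>
          \<bar>repr_kernel x VN p N k s t\<bar> \<le> M * exp (- K\<^sub>F * real N) / \<bar>s - t\<bar>))"
proof (intro allI impI)
  fix F assume F: "compact F \<and> F \<subseteq> \<Gamma>"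
  have \<rho>_cont: "continuous_on {a..b} \<rho>"
    using assms(2) by (auto simp: node_density_def intro: real_analytic_near_continuous)
  have "{a..b} \<noteq> {}" using \<open>a < b\<close> by simp
  obtain tmin where tmin: "tmin \<in> {a..b}" "\<And>t. t \<in> {a..b} \<Longrightarrow> \<rho> tmin \<le> \<rho> t"
    using continuous_attains_inf[OF compact_Icc \<open>{a..b} \<noteq> {}\<close> \<rho>_cont] by blast
  obtain tmax where tmax: "\<And>t. t \<in> {a..b} \<Longrightarrow> \<rho> t \<le> \<rho> tmax"
    using continuous_attains_sup[OF compact_Icc \<open>{a..b} \<noteq> {}\<close> \<rho>_cont] by blast
  define h H where "h = \<rho> tmin" and "H = \<rho> tmax"
  have VG: "complex_of_real ` {a..b} \<subseteq> G" "V holomorphic_on G"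
    using assms(4) by (auto simp: weight_potentials_def real_analytic_in_def)
  interpret equilibrium_setting a b h H \<rho> x c ell \<mu> \<psi> V
  proof
    show "0 < h" using assms(2) tmin(1) by (simp add: node_density_def h_def)
    show "h \<le> \<rho> t \<and> \<rho> t \<le> H" if "t \<in> {a..b}" for t
      using that tmin(2) tmax by (simp add: h_def H_def)
    show "(LBINT t:{a..b}. \<rho> t) = 1" using assms(2) by (simp add: node_density_def)
    show "admissible a b \<rho> c \<mu>"
      using assms(9) by (simp add: equilibrium_measure_def is_arg_min_def)
    show "continuous_on {a..b} (\<lambda>t. Re (V (complex_of_real t)))"
      using VG(1) by (intro continuous_intros continuous_on_compose2[OF holomorphic_on_imp_continuous_on[OF VG(2)]]) auto
  qed (use assms \<rho>_cont in auto)
  obtain u v where \<Gamma>: "a \<le> u" "u < v" "v \<le> b" "\<Gamma> = {u<..<v}" "emeasure \<mu> \<Gamma> = 0"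
    using assms(13) by (auto simp: void_interval_def maximal_subinterval_def open_subinterval_def)
  have \<Gamma>_null: "measure eq_measure \<Gamma> = 0"
  proof -
    have "\<Gamma> \<inter> {a..b} = \<Gamma>" using \<Gamma> by auto
    then show ?thesis using \<Gamma> by (simp add: measure_def emeasure_eq_measure)
  qed
  \<comment> \<open>The strict inequality in the void becomes uniform because the continuous
    function \<open>var\<close> attains its minimum on the compact set \<open>F\<close>.\<close>
  have "\<exists>\<delta>>0. \<forall>s\<in>F. ell + \<delta> \<le> var s"
  proof (cases "F = {}")
    case True
    then show ?thesis by (auto intro: exI[of _ 1])
  next
    case False
    have "continuous_on F var"
      using F \<Gamma> by (intro continuous_on_subset[OF continuous_on_var]) auto
    then obtain s0 where s0: "s0 \<in> F" "\<And>s. s \<in> F \<Longrightarrow> var s0 \<le> var s"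
      using continuous_attains_inf F False by metis
    have "ell < var s0"
      using variational assms(13) s0(1) F by (auto simp: strict_variational_conditions_def)
    then show ?thesis using s0(2) by (intro exI[of _ "var s0 - ell"]) auto
  qed
  then obtain \<delta> where \<delta>: "0 < \<delta>" "\<And>s. s \<in> F \<Longrightarrow> ell + \<delta> \<le> var s" by blast
  obtain d where d: "0 < d" "(\<Union>s\<in>F. ball s d) \<subseteq> \<Gamma>"
    using compact_subset_open_imp_ball_epsilon_subset[of F \<Gamma>] F \<Gamma>(4) by auto
  have near_null: "measure eq_measure {s - d<..<s + d} = 0" if "s \<in> F" for s
  proof -
    have "{s - d<..<s + d} \<subseteq> \<Gamma>"
      using d(2) that by (auto simp: ball_eq_greaterThanLessThan)
    then have "measure eq_measure {s - d<..<s + d} \<le> measure eq_measure \<Gamma>"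
      using \<Gamma>(4) by (intro eq.finite_measure_mono) auto
    then show ?thesis using \<Gamma>_null by (simp add: measure_le_0_iff)
  qed
  have "uniformly_continuous_on {a..b} var"
    by (intro compact_uniformly_continuous continuous_on_var) simp
  then have "\<exists>r>0. \<forall>t\<in>{a..b}. \<forall>z\<in>{a..b}. dist z t < r \<longrightarrow> dist (var z) (var t) < \<delta> / 4"
    unfolding uniformly_continuous_on_def using \<delta>(1) by (elim allE[of _ "\<delta> / 4"]) simp
  then obtain r where r: "0 < r" "\<And>t z. t \<in> {a..b} \<Longrightarrow> z \<in> {a..b} \<Longrightarrow> \<bar>z - t\<bar> < r \<Longrightarrow> \<bar>var z - var t\<bar> < \<delta> / 4"
    unfolding dist_real_def by blast
  obtain C where C: "\<forall>\<^sub>F N in sequentially. \<forall>t\<in>{a..b}.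
      \<bar>real N * Re (VN N (complex_of_real t)) - real N * Re (V (complex_of_real t)) - \<gamma>\<bar> \<le> C"
    using weight_potentials_bound[OF assms(4)] by blast
  have inverse_small: "\<forall>\<^sub>F N in sequentially. 1 / (m * real N) < e" if "0 < m" "0 < e" for m e :: real
    using that by real_asymp
  have ba: "0 < b - a" and d2: "0 < d / 2" using \<open>a < b\<close> d(1) by simp_all
  let ?bound = "\<lambda>N. exp (- (\<delta> / 2) * real N)"
  have diagonal: "\<forall>\<^sub>F N in sequentially. \<forall>k. real k = c * real N \<longrightarrow>
      (\<forall>s \<in> nodes x N \<inter> F. repr_kernel x VN p N k s s \<le> ?bound N)"
    using C eventually_gt_at_top[of 0] inverse_small[OF H_pos ba] inverse_small[OF h_pos d2]
      inverse_small[OF h_pos r(1)]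
      eventually_log_error_absorbed[OF \<delta>(1) H_pos, of "2 * C - 2 * ln (d / 2)" "ln (b - a)"]
  proof eventually_elim
    case (elim N)
    show ?case
    proof (intro allI impI ballI)
      fix k s assume k: "real k = c * real N" and s: "s \<in> nodes x N \<inter> F"
      have "repr_kernel x VN p N k s s \<le> real N * exp (- (3 / 4) * \<delta> * real N + 2 * C
          + 6 * (2 * (ln (b - a) + ln (H * real N)) + \<bar>ln (H * real N)\<bar> + 2) - 2 * ln (d / 2))"
      proof (rule kernel_diagonal_le)
        show "\<bar>var t - var z\<bar> \<le> \<delta> / 4"
          if "t \<in> {a..b}" "z \<in> {a..b}" "\<bar>t - z\<bar> \<le> 1 / (h * real N)" for t z
          using r(2)[of z t] that elim(5) by simp
      qed (use elim s k d \<delta> near_null assms(5) \<open>a < b\<close> in auto)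
      also have "\<dots> \<le> ?bound N"
        using elim(6) by (simp add: algebra_simps)
      finally show "repr_kernel x VN p N k s s \<le> ?bound N" .
    qed
  qed
  \<comment> \<open>One constant for both claims: 1 suffices on the diagonal, while off the diagonal
    \<open>b - a\<close> bounds the factor \<open>\<bar>s - t\<bar>\<close> moved to the
    denominator.\<close>
  define M where "M = max 1 (b - a)"
  have M: "1 \<le> M" "b - a \<le> M" by (auto simp: M_def)
  show "\<exists>K\<^sub>F>0. \<exists>M. \<forall>\<^sub>F N in sequentially. \<forall>k. real k = c * real N \<longrightarrow>
       (\<forall>s \<in> nodes x N \<inter> F. \<bar>repr_kernel x VN p N k s s\<bar> \<le> M * exp (- K\<^sub>F * real N)) \<and>
       (\<forall>s \<in> nodes x N \<inter> F. \<forall>t \<in> nodes x N \<inter> F. s \<noteq> t \<longrightarrow>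
          \<bar>repr_kernel x VN p N k s t\<bar> \<le> M * exp (- K\<^sub>F * real N) / \<bar>s - t\<bar>)"
  proof (rule exI[of _ "\<delta> / 2"], intro conjI exI[of _ M])
    show "0 < \<delta> / 2" using \<delta>(1) by simp
    from diagonal
    show "\<forall>\<^sub>F N in sequentially. \<forall>k. real k = c * real N \<longrightarrow>
       (\<forall>s \<in> nodes x N \<inter> F. \<bar>repr_kernel x VN p N k s s\<bar> \<le> M * ?bound N) \<and>
       (\<forall>s \<in> nodes x N \<inter> F. \<forall>t \<in> nodes x N \<inter> F. s \<noteq> t \<longrightarrow>
          \<bar>repr_kernel x VN p N k s t\<bar> \<le> M * ?bound N / \<bar>s - t\<bar>)"
    proof eventually_elim
      case (elim N)
      have bound: "\<bar>repr_kernel x VN p N k s t\<bar> \<le> ?bound N"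
        if "real k = c * real N" "s \<in> nodes x N \<inter> F" "t \<in> nodes x N \<inter> F" for k s t
        using elim that by (intro repr_kernel_le_diagonal) blast+
      have pos: "0 \<le> ?bound N" by simp
      show ?case
      proof (intro allI impI conjI ballI)
        fix k s assume "real k = c * real N" "s \<in> nodes x N \<inter> F"
        then have "\<bar>repr_kernel x VN p N k s s\<bar> \<le> ?bound N" by (intro bound)
        also have "\<dots> \<le> M * ?bound N" using mult_right_mono[OF M(1) pos] by simp
        finally show "\<bar>repr_kernel x VN p N k s s\<bar> \<le> M * ?bound N" .
      next
        fix k s t
        assume "real k = c * real N" "s \<in> nodes x N \<inter> F" "t \<in> nodes x N \<inter> F" "s \<noteq> t"
        have "s \<in> {a..b}" "t \<in> {a..b}"
          using \<open>s \<in> nodes x N \<inter> F\<close> \<open>t \<in> nodes x N \<inter> F\<close> F \<Gamma> by auto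
        then have "\<bar>s - t\<bar> \<le> M" using M(2) by auto
        have "\<bar>repr_kernel x VN p N k s t\<bar> * \<bar>s - t\<bar> \<le> ?bound N * M"
          using bound[OF \<open>real k = c * real N\<close> \<open>s \<in> nodes x N \<inter> F\<close> \<open>t \<in> nodes x N \<inter> F\<close>]
            \<open>\<bar>s - t\<bar> \<le> M\<close> pos by (rule mult_mono) simp
        then show "\<bar>repr_kernel x VN p N k s t\<bar> \<le> M * ?bound N / \<bar>s - t\<bar>"
          using \<open>s \<noteq> t\<close> by (simp add: pos_le_divide_eq mult.commute)
      qed
    qed
  qed
qed

end
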